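(* Let $m\ge 2$ be an even integer and $n\ge 1$ an integer. A cyclic and $\phi_n$-symmetric hamiltonian cycle system of $K_{m\times n}$ exists if and only if $n$ is even and, whenever $n\equiv 2\pmod 4$, also $m\equiv 2\pmod 4$.
   Context: $K_{m\times n}$ is the complete multipartite graph with $m$ parts of size $n$. Identify its vertex set with $\mathbb{Z}_{mn}$, the parts being the cosets of the subgroup $m\mathbb{Z}_{mn}$ (of order $n$); two vertices $x,y$ are adjacent iff $x-y\notin m\mathbb{Z}_{mn}$. A hamiltonian cycle system (HCS) of a graph is a set of cycles through all vertices whose edge sets partition the edge set of the graph. An HCS of $K_{m\times n}$ is cyclic if whenever $(c_0,\dots,c_{\ell-1})$ is a cycle of the system, so is $(c_0+1,\dots,c_{\ell-1}+1)$. Let $\phi_n$ be the permutation $x\mapsto x+m$ of $\mathbb{Z}_{mn}$ (a fixed-point-free automorphism of $K_{m\times n}$ of order $n$). An HCS is $\phi_n$-symmetric if every cycle of the system is mapped to itself by $\phi_n$. *)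

theory Defs
  imports Main "HOL-Library.Disjoint_Sets"
begin

text \<open>
  A graph is given by its vertex set \<open>V\<close> and its set \<open>E\<close> of edges, each edge being a two-element set
  of vertices.  A cycle \<open>(c\<^sub>0, \<dots>, c\<^sub>l\<^sub>-\<^sub>1)\<close> is written as a list; lists that differ by a
  rotation or a reversal denote the same cycle, so as a member of a cycle system a cycle is
  represented by its edge set.
\<close>

definition cycle_edges :: "'a list \<Rightarrow> 'a set set" where
  "cycle_edges c = {{c ! i, c ! (Suc i mod length c)} | i. i < length c}"

definition hamiltonian_cycle :: "'a set \<Rightarrow> 'a set set \<Rightarrow> 'a list \<Rightarrow> bool" where
  "hamiltonian_cycle V E c \<longleftrightarrow>
     length c \<ge> 3 \<and> distinct c \<and> set c = V \<and> cycle_edges c \<subseteq> E"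

definition hamiltonian_cycle_system :: "'a set \<Rightarrow> 'a set set \<Rightarrow> 'a set set set \<Rightarrow> bool" where
  "hamiltonian_cycle_system V E \<H> \<longleftrightarrow>
     (\<forall>X\<in>\<H>. \<exists>c. hamiltonian_cycle V E c \<and> X = cycle_edges c) \<and> partition_on E \<H>"

text \<open>
  The group of integers modulo \<open>m * n\<close> is represented by the residues \<open>0, \<dots>, m * n - 1\<close>.
\<close>

definition multipartite_verts :: "nat \<Rightarrow> nat \<Rightarrow> int set" where
  "multipartite_verts m n = {0..<int (m * n)}"

definition part_subgroup :: "nat \<Rightarrow> nat \<Rightarrow> int set" where
  "part_subgroup m n = {int m * k mod int (m * n) | k. k \<in> multipartite_verts m n}"

definition multipartite_edges :: "nat \<Rightarrow> nat \<Rightarrow> int set set" where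
  "multipartite_edges m n =
     {{x, y} | x y. x \<in> multipartite_verts m n \<and> y \<in> multipartite_verts m n \<and>
                    (x - y) mod int (m * n) \<notin> part_subgroup m n}"

definition translate :: "nat \<Rightarrow> nat \<Rightarrow> int \<Rightarrow> int \<Rightarrow> int" where
  "translate m n t x = (x + t) mod int (m * n)"

definition phi :: "nat \<Rightarrow> nat \<Rightarrow> int \<Rightarrow> int" where
  "phi m n = translate m n (int m)"

definition multipartite_hcs :: "nat \<Rightarrow> nat \<Rightarrow> int set set set \<Rightarrow> bool" where
  "multipartite_hcs m n \<H> \<longleftrightarrow>
     hamiltonian_cycle_system (multipartite_verts m n) (multipartite_edges m n) \<H>"

definition cyclic_hcs :: "nat \<Rightarrow> nat \<Rightarrow> int set set set \<Rightarrow> bool" where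
  "cyclic_hcs m n \<H> \<longleftrightarrow> multipartite_hcs m n \<H> \<and>
     (\<forall>c. hamiltonian_cycle (multipartite_verts m n) (multipartite_edges m n) c \<and>
          cycle_edges c \<in> \<H> \<longrightarrow> cycle_edges (map (translate m n 1) c) \<in> \<H>)"

definition phi_symmetric_hcs :: "nat \<Rightarrow> nat \<Rightarrow> int set set set \<Rightarrow> bool" where
  "phi_symmetric_hcs m n \<H> \<longleftrightarrow> multipartite_hcs m n \<H> \<and>
     (\<forall>c. hamiltonian_cycle (multipartite_verts m n) (multipartite_edges m n) c \<and>
          cycle_edges c \<in> \<H> \<longrightarrow> cycle_edges (map (phi m n) c) = cycle_edges c)"

end

theory Submission
  imports Defs "HOL-Number_Theory.Cong" "HOL-Combinatorics.Orbits"
begin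

text \<open>
  Let \<open>N = m * n\<close>.  Necessity: counting the edges at a vertex shows that the system has
  \<open>(m - 1) * n / 2\<close> cycles, so \<open>n\<close> is even.  Then a translation that fixes a cycle rotates it, and
  a cycle whose translation orbit has length \<open>d\<close> satisfies \<open>c\<^sub>i\<^sub>+\<^sub>d = c\<^sub>i + d * w\<close> with \<open>w\<close> odd.
  Hence each of its \<open>N / d\<close> periods contains a number of mixed edges, i.e. edges between even and
  odd vertices, of the parity of \<open>d\<close>.  There are \<open>N\<^sup>2 / 4\<close> mixed edges, so summing over all orbits
  shows that \<open>N / 4\<close> has the parity of the number of cycles.

  Sufficiency: it is enough to give base cycles whose differences cover each residue outside the
  parts exactly once up to sign.  With \<open>m = 2 * M\<close>, a zigzag through the even residues modulo \<open>m\<close>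
  uses \<open>M - 1\<close> even differences, and \<open>n / 2\<close> zigzags use up all of them.  Two zigzags, one on the
  even and one on the odd residues, are joined by two odd differences to a base cycle of period
  \<open>m\<close>; if \<open>n / 2\<close> is odd, one zigzag is left and closes up to a base cycle of period \<open>M\<close>.  The
  remaining odd differences are paired as \<open>a, a + 2\<close>, each pair giving a base cycle of period \<open>2\<close>.
\<close>

section \<open>Cycles and their automorphisms\<close>

definition cyc_nth :: "'a list \<Rightarrow> int \<Rightarrow> 'a" where
  "cyc_nth c i = c ! nat (i mod int (length c))"

lemma cyc_nth_of_nat: "i < length c \<Longrightarrow> cyc_nth c (int i) = c ! i"
  by (simp add: cyc_nth_def)

lemma cyc_nth_cong: "[i = j] (mod int (length c)) \<Longrightarrow> cyc_nth c i = cyc_nth c j"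
  by (simp add: cyc_nth_def cong_def)

lemma cyc_nth_eq_iff:
  assumes "distinct c" and "c \<noteq> []"
  shows "cyc_nth c i = cyc_nth c j \<longleftrightarrow> [i = j] (mod int (length c))"
proof -
  have "nat (i mod int (length c)) < length c" "nat (j mod int (length c)) < length c"
    using assms by (simp_all add: nat_less_iff)
  then show ?thesis
    using assms by (simp add: cyc_nth_def nth_eq_iff_index_eq eq_nat_nat_iff cong_def)
qed

lemma range_cyc_nth:
  assumes "c \<noteq> []"
  shows "range (cyc_nth c) = set c"
proof
  show "range (cyc_nth c) \<subseteq> set c"
    using assms by (auto simp: cyc_nth_def nat_less_iff)
  show "set c \<subseteq> range (cyc_nth c)"
    by (metis cyc_nth_of_nat in_set_conv_nth rangeI subsetI)
qed

lemma cycle_edges_altdef: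
  "cycle_edges c = (\<lambda>i. {c ! i, c ! (Suc i mod length c)}) ` {..<length c}"
  by (auto simp: cycle_edges_def)

lemma cycle_edges_eq_image:
  "cycle_edges c = (\<lambda>i. {cyc_nth c (int i), cyc_nth c (int i + 1)}) ` {..<length c}"
proof -
  have "c ! (Suc i mod length c) = cyc_nth c (int i + 1)" if "i < length c" for i
  proof -
    have "(int i + 1) mod int (length c) = int (Suc i mod length c)"
      by (simp add: zmod_int add.commute)
    then show ?thesis by (simp add: cyc_nth_def)
  qed
  then show ?thesis
    unfolding cycle_edges_altdef by (intro image_cong) (simp_all add: cyc_nth_of_nat)
qed

lemma cycle_edges_eq_range:
  assumes "c \<noteq> []"
  shows "cycle_edges c = range (\<lambda>i. {cyc_nth c i, cyc_nth c (i + 1)})"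
proof
  show "cycle_edges c \<subseteq> range (\<lambda>i. {cyc_nth c i, cyc_nth c (i + 1)})"
    by (auto simp: cycle_edges_eq_image)
  show "range (\<lambda>i. {cyc_nth c i, cyc_nth c (i + 1)}) \<subseteq> cycle_edges c"
  proof clarify
    fix i :: int
    let ?k = "nat (i mod int (length c))"
    have int_k: "int ?k = i mod int (length c)" and bound: "?k < length c"
      using assms by (simp_all add: nat_less_iff)
    have "cyc_nth c i = cyc_nth c (int ?k)" "cyc_nth c (i + 1) = cyc_nth c (int ?k + 1)"
      unfolding int_k by (rule cyc_nth_cong; simp add: cong_def mod_simps)+
    then show "{cyc_nth c i, cyc_nth c (i + 1)} \<in> cycle_edges c"
      using bound unfolding cycle_edges_eq_image by (intro image_eqI[of _ _ ?k]) simp_all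
  qed
qed

lemma cycle_edges_map: "cycle_edges (map f c) = image f ` cycle_edges c"
proof -
  have "Suc i mod length c < length c" if "i < length c" for i
    using that by (metis mod_less_divisor not_less_zero neq0_conv)
  then show ?thesis
    unfolding cycle_edges_altdef image_image by (intro image_cong) simp_all
qed

lemma cycle_edges_map_upt:
  fixes f :: "nat \<Rightarrow> 'a"
  assumes "L > 0" and periodic: "\<And>k. f (k + L) = f k"
  shows "cycle_edges (map f [0..<L]) = range (\<lambda>k. {f k, f (Suc k)})"
proof -
  have f_mod: "f (k mod L) = f k" for k
  proof (induction k rule: less_induct)
    case (less k)
    show ?case
    proof (cases "k < L")
      case False
      then show ?thesis
        using less[of "k - L"] periodic[of "k - L"] assms(1) by (simp add: le_mod_geq)
    qed simp
  qed
  have "cycle_edges (map f [0..<L]) = (\<lambda>k. {f k, f (Suc k)}) ` {..<L}"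
    unfolding cycle_edges_altdef using assms(1) by (intro image_cong) (simp_all add: f_mod)
  also have "\<dots> = range (\<lambda>k. {f k, f (Suc k)})"
  proof -
    have "{f k, f (Suc k)} = {f (k mod L), f (Suc (k mod L))}" for k
      by (metis f_mod mod_Suc_eq)
    then show ?thesis
      using assms(1) by (auto intro!: image_eqI[of _ _ "k mod L" for k])
  qed
  finally show ?thesis .
qed

lemma cyc_nth_neighbour:
  assumes "distinct c" and "c \<noteq> []" and "{cyc_nth c i, y} \<in> cycle_edges c"
  shows "y = cyc_nth c (i + 1) \<or> y = cyc_nth c (i - 1)"
proof -
  obtain j where "{cyc_nth c i, y} = {cyc_nth c j, cyc_nth c (j + 1)}"
    using assms cycle_edges_eq_range by blast
  then consider (start) "cyc_nth c i = cyc_nth c j" "y = cyc_nth c (j + 1)"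
    | (finish) "cyc_nth c i = cyc_nth c (j + 1)" "y = cyc_nth c j"
    by (auto simp: doubleton_eq_iff)
  then show ?thesis
  proof cases
    case start
    then have "[j + 1 = i + 1] (mod int (length c))"
      using assms cyc_nth_eq_iff cong_add_rcancel cong_sym by metis
    then show ?thesis using start cyc_nth_cong by blast
  next
    case finish
    then have "[j = i - 1] (mod int (length c))"
      using assms cyc_nth_eq_iff cong_add_rcancel[of j 1 "i - 1"] cong_sym
      by (metis diff_add_cancel)
    then show ?thesis using finish cyc_nth_cong by blast
  qed
qed

lemma cyc_nth_neq_two_apart:
  assumes "distinct c" and "length c \<ge> 3"
  shows "cyc_nth c (i + 2) \<noteq> cyc_nth c i"
proof
  assume "cyc_nth c (i + 2) = cyc_nth c i"
  then have "[i + 2 = i] (mod int (length c))"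
    using assms cyc_nth_eq_iff[of c] by fastforce
  then have "int (length c) dvd 2"
    by (simp add: cong_iff_dvd_diff)
  then show False using assms zdvd_imp_le by fastforce
qed

lemma inj_on_cycle_edge:
  assumes "distinct c" and "length c \<ge> 3"
  shows "inj_on (\<lambda>i. {cyc_nth c (int i), cyc_nth c (int i + 1)}) {..<length c}"
proof (rule inj_onI)
  fix i j assume bounds: "i \<in> {..<length c}" "j \<in> {..<length c}"
    and "{cyc_nth c (int i), cyc_nth c (int i + 1)} = {cyc_nth c (int j), cyc_nth c (int j + 1)}"
  then consider (same) "cyc_nth c (int i) = cyc_nth c (int j)"
    | (swapped) "cyc_nth c (int i) = cyc_nth c (int j + 1)"
        "cyc_nth c (int i + 1) = cyc_nth c (int j)"
    by (auto simp: doubleton_eq_iff)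
  then show "i = j"
  proof cases
    case same
    then show ?thesis using bounds assms(1) by (simp add: cyc_nth_of_nat nth_eq_iff_index_eq)
  next
    case swapped
    have "c \<noteq> []" using assms by auto
    then have "[int i + 1 = int j + 1 + 1] (mod int (length c))"
      using swapped(1) assms(1) by (metis cyc_nth_eq_iff cong_add_rcancel)
    then have "cyc_nth c (int j + 2) = cyc_nth c (int j)"
      using swapped(2) cyc_nth_cong by (metis add.assoc one_add_one)
    then show ?thesis using cyc_nth_neq_two_apart[OF assms] by blast
  qed
qed

lemma card_cycle_edges_at:
  assumes "distinct c" and "length c \<ge> 3" and "x \<in> set c"
  shows "card {a \<in> cycle_edges c. x \<in> a} = 2"
proof -
  have nonempty: "c \<noteq> []" using assms by auto
  obtain i where x_eq: "x = cyc_nth c i" using assms(3) range_cyc_nth[OF nonempty] by blast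
  let ?next = "{x, cyc_nth c (i + 1)}" and ?previous = "{x, cyc_nth c (i - 1)}"
  have "{a \<in> cycle_edges c. x \<in> a} = {?next, ?previous}"
  proof (intro equalityI subsetI)
    fix a assume incident: "a \<in> {a \<in> cycle_edges c. x \<in> a}"
    then obtain y where "a = {x, y}" using cycle_edges_eq_range[OF nonempty] by fastforce
    then show "a \<in> {?next, ?previous}"
      using incident x_eq cyc_nth_neighbour[OF assms(1) nonempty, of i y] by auto
  next
    have "?next \<in> cycle_edges c" using cycle_edges_eq_range[OF nonempty] x_eq by blast
    moreover have "?previous = {cyc_nth c (i - 1), cyc_nth c (i - 1 + 1)}" using x_eq by auto
    then have "?previous \<in> cycle_edges c" using cycle_edges_eq_range[OF nonempty] by blast
    ultimately show "a \<in> {a \<in> cycle_edges c. x \<in> a}" if "a \<in> {?next, ?previous}" for a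
      using that by auto
  qed
  moreover have "?next \<noteq> ?previous"
    using cyc_nth_neq_two_apart[OF assms(1,2), of "i - 1"]
    by (auto simp: doubleton_eq_iff algebra_simps)
  ultimately show ?thesis by simp
qed

lemma nonbacktracking_walk_on_cycle:
  fixes f :: "nat \<Rightarrow> 'a"
  assumes "distinct c" and "c \<noteq> []"
    and edge: "\<And>k. {f k, f (Suc k)} \<in> cycle_edges c"
    and nonbacktracking: "\<And>k. f (Suc (Suc k)) \<noteq> f k"
  obtains \<sigma> e :: int
  where "\<sigma> = 1 \<or> \<sigma> = -1" and "\<And>k. f k = cyc_nth c (e + \<sigma> * int k)"
proof -
  obtain j where "{f 0, f 1} = {cyc_nth c j, cyc_nth c (j + 1)}"
    using edge[of 0] by (auto simp: cycle_edges_eq_range[OF assms(2)])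
  then obtain e where f_0: "f 0 = cyc_nth c e"
    by (auto simp: doubleton_eq_iff)
  obtain \<sigma> :: int where sign: "\<sigma> = 1 \<or> \<sigma> = -1" and f_1: "f 1 = cyc_nth c (e + \<sigma>)"
    using edge[of 0] cyc_nth_neighbour[OF assms(1,2), of e "f 1"] f_0
    by (metis One_nat_def diff_conv_add_uminus)
  have "f k = cyc_nth c (e + \<sigma> * int k) \<and> f (Suc k) = cyc_nth c (e + \<sigma> * (int k + 1))" for k
  proof (induction k)
    case (Suc k)
    let ?i = "e + \<sigma> * (int k + 1)"
    have "{cyc_nth c ?i, f (Suc (Suc k))} \<in> cycle_edges c"
      using edge[of "Suc k"] Suc by simp
    then have "f (Suc (Suc k)) = cyc_nth c (?i + 1) \<or> f (Suc (Suc k)) = cyc_nth c (?i - 1)"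
      using cyc_nth_neighbour[OF assms(1,2)] by blast
    moreover have "f (Suc (Suc k)) \<noteq> cyc_nth c (e + \<sigma> * int k)"
      using Suc nonbacktracking by metis
    ultimately have "f (Suc (Suc k)) = cyc_nth c (e + \<sigma> * (int k + 2))"
      using sign by (auto simp: algebra_simps)
    then show ?case using Suc by (simp add: add.assoc add.commute)
  qed (use f_0 f_1 in simp)
  with sign that show thesis by blast
qed

lemma cycle_automorphism:
  assumes "distinct c" and "length c \<ge> 3"
    and inj: "inj_on g (set c)" and edges: "image g ` cycle_edges c = cycle_edges c"
  obtains \<sigma> e :: int
  where "\<sigma> = 1 \<or> \<sigma> = -1" and "\<And>i. g (cyc_nth c i) = cyc_nth c (e + \<sigma> * i)"
proof -
  have nonempty: "c \<noteq> []" using assms(2) by auto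
  obtain \<sigma> e :: int where sign: "\<sigma> = 1 \<or> \<sigma> = -1"
    and walk: "\<And>k. g (cyc_nth c (int k)) = cyc_nth c (e + \<sigma> * int k)"
  proof (rule nonbacktracking_walk_on_cycle[OF assms(1) nonempty, of "\<lambda>k. g (cyc_nth c (int k))"])
    fix k
    have "g ` {cyc_nth c (int k), cyc_nth c (int k + 1)} \<in> image g ` cycle_edges c"
      by (intro imageI) (simp add: cycle_edges_eq_range[OF nonempty])
    then show "{g (cyc_nth c (int k)), g (cyc_nth c (int (Suc k)))} \<in> cycle_edges c"
      using edges by (simp add: add.commute)
    show "g (cyc_nth c (int (Suc (Suc k)))) \<noteq> g (cyc_nth c (int k))"
      using inj range_cyc_nth[OF nonempty] cyc_nth_neq_two_apart[OF assms(1,2), of "int k"]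
      by (metis Suc_eq_plus1 add_2_eq_Suc' inj_on_eq_iff of_nat_add of_nat_numeral rangeI)
  qed (rule that)
  have "g (cyc_nth c i) = cyc_nth c (e + \<sigma> * i)" for i
  proof -
    define k where "k = nat (i mod int (length c))"
    have cong: "[int k = i] (mod int (length c))" using nonempty by (simp add: k_def)
    then have "cyc_nth c (e + \<sigma> * int k) = cyc_nth c (e + \<sigma> * i)"
      by (intro cyc_nth_cong cong_add cong_mult cong_refl)
    then show ?thesis using walk[of k] cyc_nth_cong[OF cong] by simp
  qed
  with sign that show thesis by blast
qed

lemma cycle_automorphism_rotation:
  assumes "distinct c" and "length c \<ge> 3"
    and inj: "inj_on g (set c)" and edges: "image g ` cycle_edges c = cycle_edges c"
    and no_fixpoint: "\<And>x. x \<in> set c \<Longrightarrow> g x \<noteq> x"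
    and no_flip: "\<And>x y. {x, y} \<in> cycle_edges c \<Longrightarrow> g x = y \<Longrightarrow> g y \<noteq> x"
  obtains e where "\<And>i. g (cyc_nth c i) = cyc_nth c (i + e)"
proof -
  have nonempty: "c \<noteq> []" using assms(2) by auto
  obtain \<sigma> e :: int where sign: "\<sigma> = 1 \<or> \<sigma> = -1"
    and image_eq: "\<And>i. g (cyc_nth c i) = cyc_nth c (e + \<sigma> * i)"
    by (rule cycle_automorphism[OF assms(1,2) inj edges]) (rule that)
  have "\<sigma> \<noteq> -1"
  proof
    assume reflection: "\<sigma> = -1"
    show False
    proof (cases "even e")
      case True
      then obtain i where "e = 2 * i" by (elim evenE)
      then have "g (cyc_nth c i) = cyc_nth c i" using image_eq[of i] reflection by simp
      then show False using no_fixpoint range_cyc_nth[OF nonempty] by blast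
    next
      case False
      then obtain i where "e = 2 * i + 1" by (elim oddE)
      then have "g (cyc_nth c i) = cyc_nth c (i + 1)" "g (cyc_nth c (i + 1)) = cyc_nth c i"
        using image_eq[of i] image_eq[of "i + 1"] reflection by (simp_all add: algebra_simps)
      moreover have "{cyc_nth c i, cyc_nth c (i + 1)} \<in> cycle_edges c"
        using cycle_edges_eq_range[OF nonempty] by blast
      ultimately show False using no_flip by blast
    qed
  qed
  then show thesis using that[of e] image_eq sign by (simp add: add.commute)
qed

section \<open>Sums over orbits\<close>

lemma card_orbit_eq_funpow_dist1: "x \<in> orbit f x \<Longrightarrow> card (orbit f x) = funpow_dist1 f x x"
  by (subst orbit_conv_funpow_dist1) (simp_all add: card_image inj_on_funpow_dist1)

lemma funpow_card_orbit: "x \<in> orbit f x \<Longrightarrow> (f ^^ card (orbit f x)) x = x"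
  by (simp only: card_orbit_eq_funpow_dist1 funpow_dist1_prop)

lemma self_in_orbit_of_funpow: "(f ^^ k) x = x \<Longrightarrow> k > 0 \<Longrightarrow> x \<in> orbit f x"
  unfolding orbit_altdef by force

lemma card_orbit_dvd:
  assumes "(f ^^ k) x = x" and "k > 0"
  shows "card (orbit f x) dvd k"
proof -
  let ?d = "card (orbit f x)"
  have self: "x \<in> orbit f x" using assms by (rule self_in_orbit_of_funpow)
  have "(f ^^ (k mod ?d)) x = x" using funpow_mod_eq[OF funpow_card_orbit[OF self]] assms(1) by simp
  moreover have "k mod ?d < ?d" using card_orbit_eq_funpow_dist1[OF self] by simp
  ultimately have "k mod ?d = 0"
    using funpow_dist1_least[of "k mod ?d" f x x] card_orbit_eq_funpow_dist1[OF self] by auto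
  then show ?thesis by auto
qed

lemma dvd_sum_orbits:
  fixes w :: "'a \<Rightarrow> 'b :: comm_semiring_1"
  assumes "finite S" and closed: "\<And>x. x \<in> S \<Longrightarrow> f x \<in> S" and self: "\<And>x. x \<in> S \<Longrightarrow> x \<in> orbit f x"
    and invariant: "\<And>x. x \<in> S \<Longrightarrow> w (f x) = w x"
    and dvd: "\<And>x. x \<in> S \<Longrightarrow> q dvd of_nat (card (orbit f x)) * w x"
  shows "q dvd sum w S"
proof -
  have orbit_invariant: "y \<in> S \<and> w y = w x" if "x \<in> S" "y \<in> orbit f x" for x y
    using that(2) by induction (use that(1) closed invariant in auto)
  have orbit_eq: "orbit f y = orbit f x" if "x \<in> S" "y \<in> orbit f x" for x y
    using that self orbit_cyclic_eq3 cyclic_on_def by metis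
  have "partition_on S (orbit f ` S)"
  proof (rule partition_onI)
    show "\<Union> (orbit f ` S) = S" using orbit_invariant self by blast
    show "disjnt A B" if "A \<in> orbit f ` S" "B \<in> orbit f ` S" "A \<noteq> B" for A B
      using that orbit_eq unfolding disjnt_iff by (metis imageE)
  qed (use orbit_nonempty in force)
  then have "sum w S = (\<Sum>A\<in>orbit f ` S. sum w A)"
    using assms(1) by (intro sum.partition)
  also have "q dvd \<dots>"
  proof (rule dvd_sum)
    fix A assume "A \<in> orbit f ` S"
    then obtain x where orbit_of: "x \<in> S" "A = orbit f x" by blast
    have "sum w (orbit f x) = (\<Sum>y\<in>orbit f x. w x)"
      using orbit_invariant orbit_of by (intro sum.cong) auto
    then show "q dvd sum w A" using dvd orbit_of by simp
  qed
  finally show ?thesis .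
qed

section \<open>Counting and parity\<close>

lemma card_filter_partition_on:
  assumes "finite E" and "partition_on E \<H>"
  shows "card {a \<in> E. P a} = (\<Sum>X\<in>\<H>. card {a \<in> X. P a})"
proof -
  have finite_block: "finite X" if "X \<in> \<H>" for X
    using assms that by (metis Union_upper finite_subset partition_onD1)
  have "card {a \<in> E. P a} = (\<Sum>a\<in>E. of_bool (P a))"
    using assms(1) by (simp add: Int_def)
  also have "\<dots> = (\<Sum>X\<in>\<H>. \<Sum>a\<in>X. of_bool (P a))"
    using assms by (rule sum.partition)
  also have "\<dots> = (\<Sum>X\<in>\<H>. card {a \<in> X. P a})"
    using finite_block by (intro sum.cong) (simp_all add: Int_def)
  finally show ?thesis .
qed

lemma card_filter_periodic:
  fixes P :: "nat \<Rightarrow> bool"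
  assumes periodic: "\<And>i. P (i + d) \<longleftrightarrow> P i"
  shows "card {i \<in> {..<r * d}. P i} = r * card {i \<in> {..<d}. P i}"
proof -
  have periodic_mult: "P (i + k * d) \<longleftrightarrow> P i" for i k
    by (induction k) (use periodic[of "i + k * d" for k] in \<open>simp_all add: ac_simps\<close>)
  have "card {i \<in> {..<r * d}. P i} = (\<Sum>i<r * d. of_bool (P i))"
    by (simp add: Int_def)
  also have "\<dots> = (\<Sum>k<r. \<Sum>i = k * d..<k * d + d. of_bool (P i))"
    by (rule sum.nat_group[symmetric])
  also have "\<dots> = (\<Sum>k<r. \<Sum>i<d. of_bool (P i))"
    using sum.shift_bounds_nat_ivl[of "\<lambda>i. of_bool (P i) :: nat" 0 "k * d" d for k]
    by (simp add: periodic_mult lessThan_atLeast0 add.commute[of d] del: sum_of_bool_eq)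
  also have "\<dots> = r * card {i \<in> {..<d}. P i}"
    by (simp add: Int_def)
  finally show ?thesis .
qed

lemma sum_Un_le:
  fixes w :: "'a \<Rightarrow> nat"
  assumes "finite A" and "finite B"
  shows "sum w (A \<union> B) \<le> sum w A + sum w B"
  using assms by (simp add: sum_Un_nat)

lemma sum_image_le_card_mult:
  fixes w :: "'a \<Rightarrow> nat"
  assumes "finite I" and "\<And>j. j \<in> I \<Longrightarrow> w (f j) \<le> d"
  shows "sum w (f ` I) \<le> card I * d"
proof -
  have "sum w (f ` I) \<le> card (f ` I) * d"
    using sum_bounded_above[of "f ` I" w d] assms(2) by auto
  also have "\<dots> \<le> card I * d" using assms(1) by (simp add: card_image_le)
  finally show ?thesis .
qed

lemma card_multiples_below:
  assumes "m \<ge> 1"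
  shows "card {x \<in> {0..<int m * int h}. int m dvd x} = h"
proof -
  have "{x \<in> {0..<int m * int h}. int m dvd x} = (\<lambda>k. int m * k) ` {0..<int h}"
    using assms by (auto elim!: dvdE simp: zero_le_mult_iff)
  moreover have "inj_on (\<lambda>k. int m * k) {0..<int h}" using assms by (simp add: inj_on_def)
  ultimately show ?thesis by (simp add: card_image)
qed

lemma card_nonmultiples_below:
  assumes "m \<ge> 1"
  shows "card {x \<in> {0..<int m * int h}. \<not> int m dvd x} = (m - 1) * h"
proof -
  let ?A = "{0..<int m * int h}"
  have "{x \<in> ?A. \<not> int m dvd x} = ?A - {x \<in> ?A. int m dvd x}" by auto
  also have "card \<dots> = card ?A - card {x \<in> ?A. int m dvd x}"
    by (rule card_Diff_subset) (auto intro: finite_subset[of _ ?A])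
  finally show ?thesis
    using card_multiples_below[OF assms] by (simp add: diff_mult_distrib nat_mult_distrib)
qed

lemma even_card_odd_steps:
  fixes a :: "nat \<Rightarrow> int"
  shows "even (int (card {i \<in> {..<d}. odd (a i + a (Suc i))}) - (a d - a 0))"
proof (induction d)
  case (Suc d)
  have "{i \<in> {..<Suc d}. odd (a i + a (Suc i))} =
    (if odd (a d + a (Suc d)) then insert d else id) {i \<in> {..<d}. odd (a i + a (Suc i))}"
    by (auto simp: less_Suc_eq)
  then show ?case using Suc by auto
qed simp

lemma odd_mult_eq_double_half:
  fixes M h :: nat
  assumes "odd M"
  shows "M * h = 2 * (M * h div 2) + h mod 2"
proof -
  have "M * h mod 2 = h mod 2" using assms by (simp add: mod2_eq_if)
  then show ?thesis by (metis mult_div_mod_eq)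
qed

lemma odd_in_consecutive_pairs:
  fixes x :: int
  assumes "odd x" and "odd a" and "a \<le> x" and "x < a + 4 * int K"
  obtains j where "j < K" and "x = a + 4 * int j \<or> x = a + 4 * int j + 2"
proof -
  define j where "j = nat ((x - a) div 4)"
  have "int j = (x - a) div 4" using assms(3) by (simp add: j_def)
  moreover have "even (x - a)" using assms(1,2) by simp
  ultimately have "x = a + 4 * int j \<or> x = a + 4 * int j + 2" by presburger
  moreover from this have "j < K" using assms(4) by linarith
  ultimately show thesis using that by blast
qed

lemma odd_cofactor:
  fixes d e r :: int
  assumes "d \<noteq> 0" and "r \<noteq> 0" and "even r"
    and dvd_iff: "\<And>k. r * d dvd k * e \<longleftrightarrow> r * d dvd k * d"
  obtains w where "odd w" and "[w * e = d] (mod r * d)"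
proof -
  obtain k where cofactor: "r * d = k * gcd e (r * d)" by (metis dvdE gcd_dvd2 mult.commute)
  then have "r * d dvd k * e" by (metis gcd_dvd1 mult_dvd_mono dvd_refl)
  then have "k * gcd e (r * d) dvd k * d" using dvd_iff cofactor by metis
  then have "gcd e (r * d) dvd d"
    using cofactor assms(1,2) by (metis dvd_mult_cancel_left mult_eq_0_iff)
  then obtain w where solution: "[e * w = d] (mod r * d)" using cong_solve_dvd_int by blast
  have "odd w"
  proof
    assume "even w"
    then obtain u where w_eq: "w = 2 * u" by (elim evenE)
    obtain s where r_eq: "r = 2 * s" using \<open>even r\<close> by (elim evenE)
    have "r * d dvd u * (r * e)" using dvd_iff[of r] by simp
    moreover have "r * d dvd s * (e * w - d)" using solution by (simp add: cong_iff_dvd_diff)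
    ultimately have "r * d dvd u * (r * e) - s * (e * w - d)" by (rule dvd_diff)
    then have "2 * (s * d) dvd 1 * (s * d)" by (simp add: w_eq r_eq algebra_simps)
    then show False using assms(1,2) r_eq by (simp only: dvd_mult_cancel_right) simp
  qed
  then show thesis using that solution by (simp add: mult.commute)
qed

section \<open>Translations of the complete multipartite graph\<close>

locale multipartite =
  fixes m n :: nat
  assumes m_pos: "m \<ge> 1" and n_pos: "n \<ge> 1"
begin

definition N :: int where "N = int m * int n"

abbreviation "V \<equiv> multipartite_verts m n"

abbreviation "E \<equiv> multipartite_edges m n"

abbreviation translate_edges :: "int \<Rightarrow> int set set \<Rightarrow> int set set" where
  "translate_edges t X \<equiv> image (translate m n t) ` X"

lemma N_pos: "N > 0"
  using m_pos n_pos by (simp add: N_def)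

lemma m_dvd_N: "int m dvd N"
  by (simp add: N_def)

lemma verts_eq: "V = {0..<N}"
  by (simp add: multipartite_verts_def N_def)

lemma translate_eq: "translate m n t x = (x + t) mod N"
  by (simp add: translate_def N_def)

lemma mem_part_subgroup_iff: "z mod N \<in> part_subgroup m n \<longleftrightarrow> int m dvd z"
proof
  assume "z mod N \<in> part_subgroup m n"
  then obtain k where "z mod N = int m * k mod N"
    by (auto simp: part_subgroup_def N_def)
  then show "int m dvd z"
    using m_dvd_N by (metis dvd_mod_iff dvd_triv_left)
next
  assume "int m dvd z"
  then obtain k where z_eq: "z = int m * k" by blast
  have "z mod N = int m * (k mod N) mod N" by (simp add: z_eq mod_simps)
  moreover have "k mod N \<in> V" using N_pos by (simp add: verts_eq)
  ultimately show "z mod N \<in> part_subgroup m n"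
    unfolding part_subgroup_def N_def by force
qed

lemma edges_eq: "E = {{x, y} | x y. x \<in> V \<and> y \<in> V \<and> \<not> int m dvd x - y}"
  using mem_part_subgroup_iff by (simp add: multipartite_edges_def N_def)

lemma edge_iff: "{x, y} \<in> E \<longleftrightarrow> x \<in> V \<and> y \<in> V \<and> \<not> int m dvd x - y"
  unfolding edges_eq by (auto simp: doubleton_eq_iff dvd_diff_commute)

lemma edges_subset_Pow: "E \<subseteq> Pow V"
  by (auto simp: edges_eq)

lemma finite_edges: "finite E"
  by (rule finite_subset[OF edges_subset_Pow]) (simp add: verts_eq)

lemma hamiltonian_cycle_length: "hamiltonian_cycle V E c \<Longrightarrow> int (length c) = N"
  using distinct_card[of c] N_pos by (auto simp: hamiltonian_cycle_def verts_eq)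

lemma translate_translate: "translate m n s (translate m n t x) = translate m n (s + t) x"
  by (simp add: translate_eq mod_simps ac_simps)

lemma translate_eq_self_iff: "x \<in> V \<Longrightarrow> translate m n t x = x \<longleftrightarrow> N dvd t"
  by (metis translate_eq verts_eq add_diff_cancel_left' atLeastLessThan_iff mod_eq_dvd_iff
      mod_pos_pos_trivial)

lemma inj_on_translate: "inj_on (translate m n t) V"
proof (rule inj_on_inverseI)
  fix x assume "x \<in> V"
  then show "translate m n (- t) (translate m n t x) = x"
    unfolding translate_translate by (simp add: translate_eq_self_iff)
qed

lemma translate_edges_translate_edges:
  "translate_edges s (translate_edges t X) = translate_edges (s + t) X"
  by (simp add: image_image translate_translate)

lemma translate_edges_0:
  assumes "X \<subseteq> E"
  shows "translate_edges 0 X = X"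
proof -
  have "translate m n 0 ` a = a" if "a \<in> X" for a
    using that assms edges_subset_Pow translate_eq_self_iff[of _ 0] by (force simp: image_iff)
  then show ?thesis by simp
qed

lemma funpow_translate_edges:
  assumes "X \<subseteq> E"
  shows "(translate_edges 1 ^^ k) X = translate_edges (int k) X"
proof (induction k)
  case (Suc k)
  then show ?case by (simp only: funpow.simps comp_apply translate_edges_translate_edges) simp
qed (simp add: translate_edges_0[OF assms])

lemma flipped_edge_difference:
  assumes "even n" and "x \<in> V" and "translate m n t x = y" and "translate m n t y = x"
  shows "int m dvd x - y"
proof -
  obtain k where n_eq: "n = 2 * k" using assms(1) by (elim evenE)
  have "translate m n (t + t) x = x" using assms(3,4) by (metis translate_translate)
  then have "N dvd t + t" using translate_eq_self_iff assms(2) by blast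
  then have "2 * (int m * int k) dvd 2 * t" unfolding N_def by (simp add: n_eq mult_ac)
  then have "int m dvd t" by (metis dvd_mult_cancel_left dvd_mult_left zero_neq_numeral)
  moreover have "int m dvd (x + t) - y"
    using m_dvd_N assms(3) by (metis translate_eq dvd_minus_mod dvd_trans)
  ultimately have "int m dvd (x + t) - y - t" by (rule dvd_diff[rotated])
  then show ?thesis by simp
qed

lemma translation_is_rotation:
  assumes "even n" and hamiltonian: "hamiltonian_cycle V E c" and "\<not> N dvd t"
    and invariant: "translate_edges t (cycle_edges c) = cycle_edges c"
  obtains e where "\<And>i. translate m n t (cyc_nth c i) = cyc_nth c (i + e)"
proof (rule cycle_automorphism_rotation[of c "translate m n t"])
  show "distinct c" "length c \<ge> 3" using hamiltonian by (simp_all add: hamiltonian_cycle_def)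
  show "inj_on (translate m n t) (set c)"
    using hamiltonian inj_on_translate by (simp add: hamiltonian_cycle_def)
  show "translate m n t x \<noteq> x" if "x \<in> set c" for x
    using that hamiltonian translate_eq_self_iff \<open>\<not> N dvd t\<close> by (simp add: hamiltonian_cycle_def)
  show "translate m n t y \<noteq> x" if "{x, y} \<in> cycle_edges c" "translate m n t x = y" for x y
  proof -
    have "x \<in> V" "\<not> int m dvd x - y"
      using that(1) hamiltonian edge_iff by (auto simp: hamiltonian_cycle_def)
    then show ?thesis using flipped_edge_difference assms(1) that(2) by blast
  qed
qed (use invariant that in blast)+

lemma translation_multiple:
  assumes in_V: "\<And>i. cyc_nth c i \<in> V"
    and rotation: "\<And>i. translate m n t (cyc_nth c i) = cyc_nth c (i + e)"
  shows "translate m n (k * t) (cyc_nth c i) = cyc_nth c (i + k * e)"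
proof (induction k arbitrary: i rule: int_induct[of _ 0])
  case (step1 k)
  have "translate m n ((k + 1) * t) (cyc_nth c i) =
      translate m n t (translate m n (k * t) (cyc_nth c i))"
    unfolding translate_translate by (simp add: algebra_simps)
  also have "\<dots> = cyc_nth c (i + (k + 1) * e)"
    unfolding step1.IH rotation by (simp add: algebra_simps)
  finally show ?case .
next
  case (step2 k)
  have "cyc_nth c i = translate m n t (cyc_nth c (i - e))"
    using rotation[of "i - e"] by simp
  then have "translate m n ((k - 1) * t) (cyc_nth c i) = translate m n (k * t) (cyc_nth c (i - e))"
    by (simp add: translate_translate algebra_simps)
  also have "\<dots> = cyc_nth c (i + (k - 1) * e)"
    unfolding step2.IH by (simp add: algebra_simps)
  finally show ?case .
qed (use in_V translate_eq_self_iff in simp)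

end

section \<open>Edges between even and odd vertices\<close>

definition mixed_edges :: "int set set \<Rightarrow> int set set" where
  "mixed_edges X = {a \<in> X. (\<exists>x\<in>a. even x) \<and> (\<exists>x\<in>a. odd x)}"

lemma card_mixed_cycle_edges:
  assumes "distinct c" and "length c \<ge> 3"
  shows "card (mixed_edges (cycle_edges c)) =
    card {i \<in> {..<length c}. odd (cyc_nth c (int i) + cyc_nth c (int (Suc i)))}"
proof -
  let ?edge = "\<lambda>i. {cyc_nth c (int i), cyc_nth c (int i + 1)}"
  let ?I = "{i \<in> {..<length c}. odd (cyc_nth c (int i) + cyc_nth c (int (Suc i)))}"
  have "mixed_edges (cycle_edges c) = ?edge ` ?I"
    unfolding mixed_edges_def cycle_edges_eq_image by (auto simp: add.commute)
  moreover have "inj_on ?edge ?I"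
    using inj_on_cycle_edge[OF assms] by (rule inj_on_subset) auto
  ultimately show ?thesis by (simp add: card_image)
qed

context multipartite
begin

lemma odd_translate_iff:
  assumes "even m"
  shows "odd (translate m n t x) \<longleftrightarrow> odd (x + t)"
proof -
  have "2 dvd N" using assms by (simp add: N_def)
  then show ?thesis by (simp add: translate_eq dvd_mod_iff)
qed

lemma card_mixed_edges:
  assumes "even m"
  shows "card (mixed_edges E) = (m * n div 2) * (m * n div 2)"
proof -
  define h where "h = m * n div 2"
  have N_eq: "N = int 2 * int h"
  proof -
    have "m * n = 2 * h" using assms by (simp add: h_def)
    then show ?thesis by (metis N_def of_nat_mult)
  qed
  have "bij_betw (\<lambda>(x, y). {x, y}) ({x \<in> V. even x} \<times> {y \<in> V. odd y}) (mixed_edges E)"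
  proof (rule bij_betw_imageI)
    show "inj_on (\<lambda>(x, y). {x, y}) ({x \<in> V. even x} \<times> {y \<in> V. odd y})"
      by (auto simp: inj_on_def doubleton_eq_iff)
    show "(\<lambda>(x, y). {x, y}) ` ({x \<in> V. even x} \<times> {y \<in> V. odd y}) = mixed_edges E"
    proof (intro equalityI subsetI)
      fix a assume "a \<in> (\<lambda>(x, y). {x, y}) ` ({x \<in> V. even x} \<times> {y \<in> V. odd y})"
      then obtain x y where ends: "a = {x, y}" "x \<in> V" "even x" "y \<in> V" "odd y" by auto
      then have "odd (x - y)" by simp
      then have "\<not> int m dvd x - y" using assms by (meson dvd_trans even_of_nat)
      then show "a \<in> mixed_edges E" using ends by (simp add: mixed_edges_def edge_iff)
    next
      fix a assume "a \<in> mixed_edges E"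
      then obtain x y where "a = {x, y}" "x \<in> V" "y \<in> V" "even x \<longleftrightarrow> odd y"
        by (auto simp: mixed_edges_def edges_eq)
      then have "\<exists>x\<in>V. \<exists>y\<in>V. even x \<and> odd y \<and> a = {x, y}"
        by (metis insert_commute)
      then show "a \<in> (\<lambda>(x, y). {x, y}) ` ({x \<in> V. even x} \<times> {y \<in> V. odd y})"
        by force
    qed
  qed
  from bij_betw_same_card[OF this, symmetric]
  have "card (mixed_edges E) = card {x \<in> V. even x} * card {y \<in> V. odd y}"
    by (simp only: card_cartesian_product)
  moreover have "card {x \<in> V. even x} = h" "card {y \<in> V. odd y} = h"
    using card_multiples_below[of 2 h] card_nonmultiples_below[of 2 h]
    unfolding verts_eq N_eq by simp_all
  ultimately show ?thesis by (simp add: h_def)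
qed

lemma card_mixed_edges_translate:
  assumes "even m" and "X \<subseteq> E"
  shows "card (mixed_edges (translate_edges t X)) = card (mixed_edges X)"
proof -
  have "(\<exists>x\<in>a. even (translate m n t x)) \<and> (\<exists>x\<in>a. odd (translate m n t x)) \<longleftrightarrow>
      (\<exists>x\<in>a. even x) \<and> (\<exists>x\<in>a. odd x)" for a
    using odd_translate_iff[OF assms(1), of t] by (cases "even t") auto
  then have "mixed_edges (translate_edges t X) = translate_edges t (mixed_edges X)"
    by (simp add: mixed_edges_def Compr_image_eq)
  moreover have "inj_on (image (translate m n t)) (mixed_edges X)"
  proof (rule inj_on_subset[OF inj_on_image_Pow[OF inj_on_translate]])
    show "mixed_edges X \<subseteq> Pow V" using assms(2) edges_subset_Pow by (auto simp: mixed_edges_def)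
  qed
  ultimately show ?thesis by (simp add: card_image)
qed

text \<open>The rotation that realises the translation by \<open>d\<close> generates the same group as the rotation
  by \<open>d\<close> positions, so the latter is a translation too; as this group has even order, it is one
  by an odd multiple of \<open>d\<close>.\<close>

lemma cycle_period_translation:
  assumes "even n" and hamiltonian: "hamiltonian_cycle V E c" and m_eq: "m = k * d"
    and invariant: "translate_edges (int d) (cycle_edges c) = cycle_edges c"
  obtains w where "odd w"
    and "\<And>i. cyc_nth c (i + int d) = translate m n (w * int d) (cyc_nth c i)"
proof -
  define r where "r = int (k * n)"
  have N_eq: "N = r * int d" unfolding N_def by (simp add: r_def m_eq mult_ac)
  then have "r * int d > 0" using N_pos by simp
  then have nonzero: "int d \<noteq> 0" "r \<noteq> 0" by (auto simp: zero_less_mult_iff)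
  have "even r" using assms(1) by (simp add: r_def)
  have length_c: "int (length c) = N" using hamiltonian_cycle_length[OF hamiltonian] .
  have cycle: "distinct c" "c \<noteq> []" "set c = V"
    using hamiltonian by (auto simp: hamiltonian_cycle_def)
  have in_V: "cyc_nth c i \<in> V" for i using range_cyc_nth[OF cycle(2)] cycle(3) by blast
  have "\<not> N dvd int d"
  proof
    assume "N dvd int d"
    then have "r * int d dvd 1 * int d" by (simp add: N_eq)
    then have "r dvd 1" using nonzero(1) by (simp only: dvd_mult_cancel_right) simp
    then have "even (1 :: int)" using \<open>even r\<close> by (rule dvd_trans[rotated])
    then show False by simp
  qed
  then obtain e where "\<And>i. translate m n (int d) (cyc_nth c i) = cyc_nth c (i + e)"
    by (rule translation_is_rotation[OF assms(1) hamiltonian _ invariant]) (rule that)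
  then have multiple: "translate m n (j * int d) (cyc_nth c i) = cyc_nth c (i + j * e)" for i j
    by (rule translation_multiple[OF in_V])
  have "r * int d dvd j * e \<longleftrightarrow> r * int d dvd j * int d" for j
    unfolding N_eq[symmetric]
    using cyc_nth_eq_iff[OF cycle(1,2), of "j * e" 0] multiple[where i = 0]
      translate_eq_self_iff[OF in_V[of 0], of "j * int d"]
    by (simp add: length_c cong_0_iff)
  then obtain w where "odd w" and cong: "[w * e = int d] (mod N)"
    unfolding N_eq by (rule odd_cofactor[OF nonzero \<open>even r\<close>])
  have "cyc_nth c (i + int d) = cyc_nth c (i + w * e)" for i
    using cong by (intro cyc_nth_cong) (simp add: length_c cong_add_lcancel cong_sym)
  then show thesis using that[OF \<open>odd w\<close>] multiple by simp
qed

lemma card_mixed_edges_periodic_cycle: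
  assumes "even m" and "even n" and hamiltonian: "hamiltonian_cycle V E c" and m_eq: "m = k * d"
    and invariant: "translate_edges (int d) (cycle_edges c) = cycle_edges c"
  obtains s where "card (mixed_edges (cycle_edges c)) = k * n * s" and "even (s + d)"
proof -
  define a where "a i = cyc_nth c (int i)" for i
  define s where "s = card {i \<in> {..<d}. odd (a i + a (Suc i))}"
  obtain w where "odd w"
    and "\<And>i. cyc_nth c (i + int d) = translate m n (w * int d) (cyc_nth c i)"
    by (rule cycle_period_translation[OF assms(2) hamiltonian m_eq invariant]) (rule that)
  then have parity: "odd (a (i + d)) \<longleftrightarrow> odd (a i + w * int d)" for i
    by (simp add: a_def odd_translate_iff[OF assms(1)])
  have "int (length c) = int (k * n * d)"
    using hamiltonian_cycle_length[OF hamiltonian] unfolding N_def by (simp add: m_eq)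
  then have length_c: "length c = k * n * d" by (simp only: of_nat_eq_iff)
  have "card (mixed_edges (cycle_edges c)) = card {i \<in> {..<length c}. odd (a i + a (Suc i))}"
    unfolding a_def using hamiltonian
    by (intro card_mixed_cycle_edges) (simp_all add: hamiltonian_cycle_def)
  also have "\<dots> = k * n * s"
    unfolding length_c s_def
  proof (rule card_filter_periodic)
    show "odd (a (i + d) + a (Suc (i + d))) \<longleftrightarrow> odd (a i + a (Suc i))" for i
      using parity[of i] parity[of "Suc i"] by auto
  qed
  finally have "card (mixed_edges (cycle_edges c)) = k * n * s" .
  moreover have "even (s + d)"
    using even_card_odd_steps[of d a] parity[of 0] \<open>odd w\<close> unfolding s_def by auto
  ultimately show thesis using that by blast
qed

end

section \<open>Necessity\<close>

locale cyclic_symmetric_system = multipartite +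
  fixes \<H> :: "int set set set"
  assumes even_m: "even m" and cyclic: "cyclic_hcs m n \<H>" and symmetric: "phi_symmetric_hcs m n \<H>"
begin

lemma partition: "partition_on E \<H>"
  using cyclic by (simp add: cyclic_hcs_def multipartite_hcs_def hamiltonian_cycle_system_def)

lemma finite_system: "finite \<H>"
  using finite_edges partition by (rule finite_elements)

lemma subset_edges: "X \<in> \<H> \<Longrightarrow> X \<subseteq> E"
  using partition by (auto simp: partition_on_def)

lemma hamiltonian_cycleE:
  assumes "X \<in> \<H>"
  obtains c where "hamiltonian_cycle V E c" and "X = cycle_edges c"
  using assms cyclic
  unfolding cyclic_hcs_def multipartite_hcs_def hamiltonian_cycle_system_def by blast

lemma translate_1_mem:
  assumes "X \<in> \<H>"
  shows "translate_edges 1 X \<in> \<H>"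
proof -
  obtain c where "hamiltonian_cycle V E c" "X = cycle_edges c"
    using assms by (rule hamiltonian_cycleE)
  then show ?thesis using cyclic assms by (simp add: cyclic_hcs_def cycle_edges_map)
qed

lemma translate_m_fixed:
  assumes "X \<in> \<H>"
  shows "translate_edges (int m) X = X"
proof -
  obtain c where "hamiltonian_cycle V E c" "X = cycle_edges c"
    using assms by (rule hamiltonian_cycleE)
  then show ?thesis
    using symmetric assms by (simp add: phi_symmetric_hcs_def phi_def cycle_edges_map)
qed

lemma card_system: "2 * card \<H> = (m - 1) * n"
proof -
  have V_0: "0 \<in> V" using N_pos by (simp add: verts_eq)
  have degree_2: "card {a \<in> X. 0 \<in> a} = 2" if "X \<in> \<H>" for X
  proof -
    obtain c where "hamiltonian_cycle V E c" "X = cycle_edges c"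
      using \<open>X \<in> \<H>\<close> by (rule hamiltonian_cycleE)
    then show ?thesis using card_cycle_edges_at[of c 0] V_0 by (simp add: hamiltonian_cycle_def)
  qed
  have "{a \<in> E. 0 \<in> a} = (\<lambda>y. {0, y}) ` {y \<in> V. \<not> int m dvd y}"
  proof (intro equalityI subsetI)
    fix a assume "a \<in> {a \<in> E. 0 \<in> a}"
    then obtain y where "a = {0, y}" "{0, y} \<in> E" by (auto simp: edges_eq)
    then show "a \<in> (\<lambda>y. {0, y}) ` {y \<in> V. \<not> int m dvd y}" by (simp add: edge_iff)
  qed (use V_0 edge_iff in auto)
  moreover have "inj_on (\<lambda>y. {0, y}) {y \<in> V. \<not> int m dvd y}"
    by (auto simp: inj_on_def doubleton_eq_iff)
  ultimately have "card {a \<in> E. 0 \<in> a} = (m - 1) * n"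
    using card_nonmultiples_below[OF m_pos, of n] by (simp add: card_image verts_eq N_def)
  then show ?thesis
    using card_filter_partition_on[OF finite_edges partition, of "\<lambda>a. 0 \<in> a"] degree_2 by simp
qed

lemma even_n: "even n"
proof -
  have "even ((m - 1) * n)" by (metis card_system dvd_triv_left)
  then show ?thesis using even_m m_pos by simp
qed

lemma funpow_translate_m: "X \<in> \<H> \<Longrightarrow> (translate_edges 1 ^^ m) X = X"
  using funpow_translate_edges subset_edges translate_m_fixed by simp

lemma self_in_orbit: "X \<in> \<H> \<Longrightarrow> X \<in> orbit (translate_edges 1) X"
  using m_pos by (intro self_in_orbit_of_funpow[OF funpow_translate_m]) simp_all

lemma orbit_excess:
  assumes "X \<in> \<H>"
  shows "2 * N dvd int (card (orbit (translate_edges 1) X)) * (int (card (mixed_edges X)) - N)"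
proof -
  define d where "d = card (orbit (translate_edges 1) X)"
  have "d dvd m"
    using card_orbit_dvd[OF funpow_translate_m[OF assms]] m_pos by (simp add: d_def)
  then obtain k where m_eq: "m = k * d" by (metis dvd_def mult.commute)
  have "translate_edges (int d) X = X"
    using funpow_card_orbit[OF self_in_orbit[OF assms]]
      funpow_translate_edges[OF subset_edges[OF assms]]
    by (simp add: d_def)
  moreover obtain c where "hamiltonian_cycle V E c" "X = cycle_edges c"
    using assms by (rule hamiltonian_cycleE)
  ultimately obtain s where card_mixed: "card (mixed_edges X) = k * n * s" and "even (s + d)"
    using card_mixed_edges_periodic_cycle[OF even_m even_n _ m_eq] by metis
  have "int d * (int (card (mixed_edges X)) - N) = N * (int s - int d)"
    unfolding card_mixed N_def by (simp add: m_eq algebra_simps)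
  moreover have "even (int s - int d)" using \<open>even (s + d)\<close> by simp
  ultimately show ?thesis by (simp add: d_def mult.commute[of 2])
qed

lemma even_card_system: "even (m * n div 4 + card \<H>)"
proof -
  have "2 * N dvd (\<Sum>X\<in>\<H>. int (card (mixed_edges X)) - N)"
    using finite_system translate_1_mem self_in_orbit
  proof (rule dvd_sum_orbits)
    show "int (card (mixed_edges (translate_edges 1 X))) - N = int (card (mixed_edges X)) - N"
      if "X \<in> \<H>" for X
      using card_mixed_edges_translate[OF even_m subset_edges[OF that]] by simp
  qed (use orbit_excess in blast)+
  also have "(\<Sum>X\<in>\<H>. int (card (mixed_edges X)) - N) = N * (int (m * n div 4) - int (card \<H>))"
  proof -
    obtain a b where halves: "m = 2 * a" "n = 2 * b" using even_m even_n by (auto elim!: evenE)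
    have "(\<Sum>X\<in>\<H>. card (mixed_edges X)) = card (mixed_edges E)"
      unfolding mixed_edges_def
      by (rule card_filter_partition_on[OF finite_edges partition, symmetric])
    also have "\<dots> = m * n * (m * n div 4)"
      unfolding card_mixed_edges[OF even_m] by (simp add: halves)
    finally show ?thesis
      by (simp add: sum_subtractf N_def algebra_simps flip: of_nat_sum)
  qed
  finally have "N * 2 dvd N * (int (m * n div 4) - int (card \<H>))" by (simp add: mult.commute)
  then have "even (int (m * n div 4) - int (card \<H>))" using N_pos by simp
  then show ?thesis by (simp flip: of_nat_add)
qed

theorem m_mod_4_eq_2:
  assumes "n mod 4 = 2"
  shows "m mod 4 = 2"
proof (rule ccontr)
  assume "m mod 4 \<noteq> 2"
  then have "4 dvd m" using even_m by presburger
  then obtain a where m_eq: "m = 4 * a" by blast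
  obtain b where n_eq: "n = 2 * b" and "odd b"
  proof
    show "n = 2 * (n div 2)" "odd (n div 2)" using assms by presburger+
  qed
  have "card \<H> = (m - 1) * b" using card_system n_eq by simp
  moreover have "m * n div 4 = 2 * (a * b)" using m_eq n_eq by simp
  ultimately have "even ((m - 1) * b)" using even_card_system by simp
  then show False using \<open>odd b\<close> even_m m_pos by simp
qed

end

section \<open>Base cycles\<close>

datatype base_cycle = Base_Cycle (period: nat) (winding: int) (base: "nat \<Rightarrow> int")

text \<open>The base cycle with period \<open>d\<close>, winding \<open>v\<close> and vertices \<open>b\<^sub>0, \<dots>, b\<^sub>d\<^sub>-\<^sub>1\<close> stands for the
  closed walk often written \<open>[b\<^sub>0, \<dots>, b\<^sub>d\<^sub>-\<^sub>1]\<^bsub>dv\<^esub>\<close>.\<close>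

definition walk :: "base_cycle \<Rightarrow> nat \<Rightarrow> int" where
  "walk B k = base B (k mod period B) + int (period B) * winding B * int (k div period B)"

definition difference :: "base_cycle \<Rightarrow> nat \<Rightarrow> int" where
  "difference B k = walk B (Suc k) - walk B k"

definition difference_lengths :: "base_cycle \<Rightarrow> int set" where
  "difference_lengths B = (\<lambda>i. \<bar>difference B i\<bar>) ` {..<period B}"

definition proper_base_cycle :: "int \<Rightarrow> base_cycle \<Rightarrow> bool" where
  "proper_base_cycle N B \<longleftrightarrow> int (period B) dvd N \<and> coprime (winding B) (N div int (period B)) \<and>
     inj_on (\<lambda>i. base B i mod int (period B)) {..<period B}"

definition unfolded_cycle :: "int \<Rightarrow> base_cycle \<Rightarrow> int \<Rightarrow> int list" where
  "unfolded_cycle N B t = map (\<lambda>k. (walk B k + t) mod N) [0..<nat N]"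

definition base_edges :: "int \<Rightarrow> base_cycle \<Rightarrow> int \<Rightarrow> int set set" where
  "base_edges N B t =
    {{x mod N, (x + difference B i) mod N} | x i.
      i < period B \<and> [x = walk B i + t] (mod int (period B))}"

lemma walk_add_periods:
  assumes "period B > 0"
  shows "walk B (k + q * period B) = walk B k + int (period B) * (winding B * int q)"
  using assms by (simp add: walk_def algebra_simps)

lemma proper_base_cycleE:
  assumes "proper_base_cycle N B" and "N > 0"
  obtains r :: nat where "N = int (period B) * int r" and "period B > 0" and "r > 0"
    and "coprime (winding B) (int r)"
proof
  have N_eq: "N = int (period B) * (N div int (period B))"
    using assms(1) by (simp add: proper_base_cycle_def)
  then have pos: "int (period B) > 0" "N div int (period B) > 0"
    using assms(2) by (smt (verit) of_nat_0_le_iff zero_less_mult_iff)+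
  then show "N = int (period B) * int (nat (N div int (period B)))" using N_eq by simp
  show "period B > 0" "nat (N div int (period B)) > 0" using pos by simp_all
  show "coprime (winding B) (int (nat (N div int (period B))))"
    using assms(1) pos by (simp add: proper_base_cycle_def)
qed

lemma cong_walk_imp_cong:
  assumes proper: "proper_base_cycle N B" and "N > 0" and cong: "[walk B k = walk B l] (mod N)"
  shows "[int k = int l] (mod N)"
proof -
  define d where "d = period B"
  obtain r where N_eq: "N = int d * int r" and "d > 0" and coprime: "coprime (winding B) (int r)"
    unfolding d_def using proper \<open>N > 0\<close> by (rule proper_base_cycleE)
  have inj: "inj_on (\<lambda>i. base B i mod int d) {..<d}"
    using proper by (simp add: proper_base_cycle_def d_def)
  have walk: "[walk B i = base B (i mod d)] (mod int d)" for i
    by (simp add: walk_def cong_iff_dvd_diff flip: d_def)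
  have "[walk B k = walk B l] (mod int d)"
    using cong N_eq cong_modulus_mult by blast
  then have "[base B (k mod d) = base B (l mod d)] (mod int d)"
    using walk cong_sym cong_trans by meson
  then have mod_eq: "k mod d = l mod d"
    using inj_onD[OF inj, of "k mod d" "l mod d"] \<open>d > 0\<close> by (simp add: cong_def)
  have "walk B k - walk B l = int d * (winding B * (int (k div d) - int (l div d)))"
    using mod_eq by (simp add: walk_def algebra_simps flip: d_def)
  then have "int r dvd winding B * (int (k div d) - int (l div d))"
    using cong \<open>d > 0\<close> by (simp add: cong_iff_dvd_diff N_eq)
  then have "int r dvd int (k div d) - int (l div d)"
    using coprime by (metis coprime_commute coprime_dvd_mult_right_iff)
  moreover have "int i = int d * int (i div d) + int (i mod d)" for i
    by (simp flip: of_nat_mult of_nat_add)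
  from this[of k] this[of l] have "int k - int l = int d * (int (k div d) - int (l div d))"
    using mod_eq by (simp add: right_diff_distrib)
  ultimately show ?thesis by (simp add: cong_iff_dvd_diff N_eq)
qed

lemma ex_walk_shift:
  assumes "proper_base_cycle N B" and "N > 0"
  obtains q where "\<And>k. [walk B (k + q * period B) = walk B k + int (period B) * j] (mod N)"
proof -
  obtain r where N_eq: "N = int (period B) * int r" and d_pos: "period B > 0" and "r > 0"
    and coprime: "coprime (winding B) (int r)"
    using assms by (rule proper_base_cycleE)
  obtain u where inverse: "[winding B * u = 1] (mod int r)"
    using cong_solve_coprime_int[OF coprime] by blast
  define q where "q = nat (u * j mod int r)"
  have "[winding B * int q = winding B * (u * j)] (mod int r)"
    using \<open>r > 0\<close> by (intro cong_scalar_left) (simp add: q_def)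
  also have "[winding B * (u * j) = j] (mod int r)"
    using cong_scalar_right[OF inverse, of j] by (simp add: mult.assoc)
  finally have "[int (period B) * (winding B * int q) = int (period B) * j] (mod N)"
    unfolding N_eq by (rule cong_cmult_leftI)
  then show thesis
    using that[of q] by (simp add: walk_add_periods[OF d_pos] cong_add_lcancel)
qed

lemma range_walk_eq_base_edges:
  assumes proper: "proper_base_cycle N B" and "N > 0"
  shows "range (\<lambda>k. {(walk B k + t) mod N, (walk B (Suc k) + t) mod N}) = base_edges N B t"
proof (intro equalityI subsetI)
  fix a assume "a \<in> range (\<lambda>k. {(walk B k + t) mod N, (walk B (Suc k) + t) mod N})"
  then obtain k where a_eq: "a = {(walk B k + t) mod N, (walk B (Suc k) + t) mod N}" by blast
  have "period B > 0" using proper \<open>N > 0\<close> by (rule proper_base_cycleE)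
  define i x where "i = k mod period B" and "x = walk B k + t"
  have walk: "walk B k = walk B i + int (period B) * (winding B * int (k div period B))"
    "walk B (Suc k) = walk B (Suc i) + int (period B) * (winding B * int (k div period B))"
    using walk_add_periods[OF \<open>period B > 0\<close>, of i "k div period B"]
      walk_add_periods[OF \<open>period B > 0\<close>, of "Suc i" "k div period B"]
    by (simp_all add: i_def)
  then have "a = {x mod N, (x + difference B i) mod N}"
    by (simp add: a_eq x_def difference_def algebra_simps)
  moreover have "[x = walk B i + t] (mod int (period B))"
    by (simp add: x_def walk cong_iff_dvd_diff)
  moreover have "i < period B" using \<open>period B > 0\<close> by (simp add: i_def)
  ultimately show "a \<in> base_edges N B t" unfolding base_edges_def by blast
next
  fix a assume "a \<in> base_edges N B t"
  then obtain x i where a_eq: "a = {x mod N, (x + difference B i) mod N}"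
    and "[x = walk B i + t] (mod int (period B))"
    unfolding base_edges_def by blast
  then obtain j where x_eq: "x = walk B i + t + int (period B) * j"
    by (metis cong_iff_lin cong_sym)
  obtain q where "\<And>k. [walk B (k + q * period B) = walk B k + int (period B) * j] (mod N)"
    by (rule ex_walk_shift[OF proper \<open>N > 0\<close>, of j]) (rule that)
  then have "[walk B (k + q * period B) + t = walk B k + t + int (period B) * j] (mod N)" for k
    by (simp add: cong_iff_dvd_diff algebra_simps)
  then have "(walk B k + t + int (period B) * j) mod N = (walk B (k + q * period B) + t) mod N"
    for k
    by (simp add: cong_def)
  moreover have "a = {(walk B i + t + int (period B) * j) mod N,
      (walk B (Suc i) + t + int (period B) * j) mod N}"
    by (simp add: a_eq x_eq difference_def algebra_simps)
  ultimately
  have "a = {(walk B (i + q * period B) + t) mod N, (walk B (Suc (i + q * period B)) + t) mod N}"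
    by (simp flip: add_Suc)
  then show "a \<in> range (\<lambda>k. {(walk B k + t) mod N, (walk B (Suc k) + t) mod N})" by blast
qed

lemma cycle_edges_unfolded_cycle:
  assumes proper: "proper_base_cycle N B" and "N > 0"
  shows "cycle_edges (unfolded_cycle N B t) = base_edges N B t"
proof -
  obtain r where N_eq: "N = int (period B) * int r" and d_pos: "period B > 0"
    using proper \<open>N > 0\<close> by (rule proper_base_cycleE)
  have "nat N = r * period B" by (simp add: N_eq nat_mult_distrib)
  then have "walk B (k + nat N) = walk B k + N * winding B" for k
    using walk_add_periods[OF d_pos, of k r] by (simp add: N_eq)
  then have "(walk B (k + nat N) + t) mod N = (walk B k + t) mod N" for k
    by (simp add: cong_iff_dvd_diff flip: cong_def)
  then show ?thesis
    unfolding unfolded_cycle_def using proper \<open>N > 0\<close>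
    by (subst cycle_edges_map_upt) (simp_all add: range_walk_eq_base_edges)
qed

lemma unfolded_cycle_covers_residues:
  assumes proper: "proper_base_cycle N B" and "N > 0"
  shows "distinct (unfolded_cycle N B t)" and "set (unfolded_cycle N B t) = {0..<N}"
proof -
  have "inj_on (\<lambda>k. (walk B k + t) mod N) {..<nat N}"
  proof (rule inj_onI)
    fix k l assume bounds: "k \<in> {..<nat N}" "l \<in> {..<nat N}"
      and "(walk B k + t) mod N = (walk B l + t) mod N"
    then have "[walk B k = walk B l] (mod N)"
      by (simp only: cong_add_rcancel flip: cong_def)
    then have "[int k = int l] (mod N)" by (rule cong_walk_imp_cong[OF proper \<open>N > 0\<close>])
    then show "k = l" using bounds by (simp add: cong_def zless_nat_eq_int_zless)
  qed
  then show distinct: "distinct (unfolded_cycle N B t)"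
    by (simp add: unfolded_cycle_def distinct_map atLeast0LessThan)
  show "set (unfolded_cycle N B t) = {0..<N}"
  proof (rule card_subset_eq)
    show "set (unfolded_cycle N B t) \<subseteq> {0..<N}" using \<open>N > 0\<close> by (auto simp: unfolded_cycle_def)
    show "card (set (unfolded_cycle N B t)) = card {0..<N}"
      using distinct_card[OF distinct] by (simp add: unfolded_cycle_def)
  qed simp
qed

lemma base_edges_cong:
  assumes "[t = t'] (mod int (period B))"
  shows "base_edges N B t = base_edges N B t'"
proof -
  have "[x = walk B i + t] (mod int (period B)) \<longleftrightarrow> [x = walk B i + t'] (mod int (period B))" for x i
    using assms by (meson cong_add_lcancel cong_sym cong_trans)
  then show ?thesis by (simp add: base_edges_def)
qed

section \<open>Congruence up to sign\<close>

definition cong_up_to_sign :: "int \<Rightarrow> int \<Rightarrow> int \<Rightarrow> bool" where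
  "cong_up_to_sign N x y \<longleftrightarrow> [x = y] (mod N) \<or> [x = - y] (mod N)"

lemma cong_up_to_sign_trans:
  assumes "cong_up_to_sign N x y" and "cong_up_to_sign N y z"
  shows "cong_up_to_sign N x z"
proof -
  have "[- y = - z] (mod N) \<or> [- y = z] (mod N)"
    using assms(2) cong_minus_minus_iff[of y z N] cong_minus_minus_iff[of y "- z" N]
    by (auto simp: cong_up_to_sign_def)
  then show ?thesis
    using assms unfolding cong_up_to_sign_def by (metis cong_trans)
qed

lemma dvd_imp_eq_0:
  fixes z :: int
  assumes "N dvd z" and "\<bar>z\<bar> < N"
  shows "z = 0"
  using assms dvd_imp_le_int[of z N] by fastforce

lemma cong_up_to_sign_imp_abs_eq:
  assumes "cong_up_to_sign N x y" and "2 * \<bar>x\<bar> < N" and "2 * \<bar>y\<bar> < N"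
  shows "\<bar>x\<bar> = \<bar>y\<bar>"
proof -
  have "N dvd x - y \<or> N dvd x + y"
    using assms(1) by (simp add: cong_up_to_sign_def cong_iff_dvd_diff)
  moreover have "\<bar>x - y\<bar> < N" "\<bar>x + y\<bar> < N" using assms(2,3) by linarith+
  ultimately have "x - y = 0 \<or> x + y = 0" using dvd_imp_eq_0 by blast
  then show ?thesis by auto
qed

lemma ex_length_cong_up_to_sign:
  assumes "N > 0"
  obtains x where "0 \<le> x" and "2 * x \<le> N" and "cong_up_to_sign N z x"
proof (cases "2 * (z mod N) \<le> N")
  case True
  then show thesis using that[of "z mod N"] assms by (simp add: cong_up_to_sign_def)
next
  case False
  have "[z = - (N - z mod N)] (mod N)" by (simp add: cong_def)
  then show thesis
    using that[of "N - z mod N"] False assms pos_mod_bound[OF assms, of z]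
    by (simp add: cong_up_to_sign_def)
qed

section \<open>Systems generated by base cycles\<close>

locale base_cycle_family = multipartite +
  fixes \<B> :: "base_cycle set"
  assumes m_ge_2: "m \<ge> 2" and even_n: "even n" and finite_family: "finite \<B>"
    and proper: "B \<in> \<B> \<Longrightarrow> proper_base_cycle N B"
    and period_dvd: "B \<in> \<B> \<Longrightarrow> period B dvd m"
    and lengths_covered:
      "0 < x \<Longrightarrow> 2 * x < N \<Longrightarrow> \<not> int m dvd x \<Longrightarrow> x \<in> (\<Union>B\<in>\<B>. difference_lengths B)"
    and sum_periods: "2 * (\<Sum>B\<in>\<B>. period B) \<le> (m - 1) * n"
begin

text \<open>There are \<open>(m - 1) * n / 2\<close> lengths to be covered, so the bound on the periods leaves no room
  for a length to occur twice.\<close>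

lemma bij_betw_lengths:
  "bij_betw (\<lambda>(B, i). \<bar>difference B i\<bar>) (SIGMA B:\<B>. {..<period B})
    {x \<in> {0..<int m * int (n div 2)}. \<not> int m dvd x}"
  (is "bij_betw ?f ?I ?L")
proof (rule bij_betw_imageI)
  have N_eq: "N = 2 * (int m * int (n div 2))"
    using even_n by (auto simp: N_def elim!: evenE)
  have finite: "finite ?I" using finite_family by simp
  have "x \<in> ?f ` ?I" if x: "x \<in> ?L" for x
  proof -
    have "x \<noteq> 0" using x by auto
    then have "x \<in> (\<Union>B\<in>\<B>. difference_lengths B)" using x N_eq by (intro lengths_covered) auto
    then show ?thesis by (force simp: difference_lengths_def)
  qed
  then have subset: "?L \<subseteq> ?f ` ?I" by blast
  moreover have "card ?I \<le> card ?L"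
    using sum_periods finite_family even_n card_nonmultiples_below[OF m_pos, of "n div 2"]
    by auto
  moreover have "card ?L \<le> card (?f ` ?I)" "card (?f ` ?I) \<le> card ?I"
    using subset finite by (auto intro: card_mono card_image_le)
  ultimately have "card ?L = card (?f ` ?I)" "card (?f ` ?I) = card ?I" by linarith+
  then show "?f ` ?I = ?L" "inj_on ?f ?I"
    using card_subset_eq[OF finite_imageI[OF finite] subset] eq_card_imp_inj_on[OF finite]
    by simp_all
qed

lemma difference_bound: "B \<in> \<B> \<Longrightarrow> i < period B \<Longrightarrow> 2 * \<bar>difference B i\<bar> < N"
  and not_dvd_difference: "B \<in> \<B> \<Longrightarrow> i < period B \<Longrightarrow> \<not> int m dvd difference B i"
proof -
  assume "B \<in> \<B>" "i < period B"
  then have "\<bar>difference B i\<bar> \<in> {x \<in> {0..<int m * int (n div 2)}. \<not> int m dvd x}"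
    using bij_betwE[OF bij_betw_lengths] by auto
  then have "2 * \<bar>difference B i\<bar> < 2 * (int m * int (n div 2))" "\<not> int m dvd difference B i"
    by auto
  then show "2 * \<bar>difference B i\<bar> < N" "\<not> int m dvd difference B i"
    using even_n by (auto simp: N_def elim!: evenE)
qed

lemma difference_eq_index:
  assumes "B \<in> \<B>" "i < period B" and "B' \<in> \<B>" "i' < period B'"
    and "cong_up_to_sign N (difference B i) (difference B' i')"
  shows "B = B' \<and> i = i'"
proof -
  have "\<bar>difference B i\<bar> = \<bar>difference B' i'\<bar>"
    using assms difference_bound by (intro cong_up_to_sign_imp_abs_eq)
  then show ?thesis
    using assms inj_onD[OF bij_betw_imp_inj_on[OF bij_betw_lengths], of "(B, i)" "(B', i')"] by simp
qed

lemma ex_difference: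
  assumes "\<not> int m dvd z"
  obtains B i where "B \<in> \<B>" and "i < period B" and "cong_up_to_sign N z (difference B i)"
proof -
  obtain x where bounds: "0 \<le> x" "2 * x \<le> N" and cong_z: "cong_up_to_sign N z x"
    using ex_length_cong_up_to_sign[OF N_pos] .
  have "int m dvd z \<longleftrightarrow> int m dvd x"
    using cong_z m_dvd_N cong_dvd_modulus cong_dvd_iff unfolding cong_up_to_sign_def
    by (metis dvd_minus_iff)
  then have not_dvd: "\<not> int m dvd x" using assms by simp
  have "2 * x \<noteq> N"
  proof
    assume "2 * x = N"
    then have "x = int m * int (n div 2)" using even_n by (auto simp: N_def elim!: evenE)
    then show False using not_dvd by simp
  qed
  moreover have "x \<noteq> 0" using not_dvd by auto
  ultimately obtain B i where "B \<in> \<B>" "i < period B" "x = \<bar>difference B i\<bar>"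
    using lengths_covered[of x] bounds not_dvd by (auto simp: difference_lengths_def)
  moreover have "cong_up_to_sign N \<bar>y\<bar> y" for y
    by (auto simp: cong_up_to_sign_def abs_if)
  ultimately show thesis using that cong_z cong_up_to_sign_trans by blast
qed

lemma base_edges_subset:
  assumes "B \<in> \<B>"
  shows "base_edges N B t \<subseteq> E"
proof
  fix a assume "a \<in> base_edges N B t"
  then obtain x i where a_eq: "a = {x mod N, (x + difference B i) mod N}" and "i < period B"
    unfolding base_edges_def by blast
  have "[x mod N - (x + difference B i) mod N = - difference B i] (mod N)"
    by (simp add: cong_def mod_simps)
  then have "[x mod N - (x + difference B i) mod N = - difference B i] (mod int m)"
    using m_dvd_N by (rule cong_dvd_modulus)
  then have "\<not> int m dvd x mod N - (x + difference B i) mod N"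
    using not_dvd_difference[OF assms \<open>i < period B\<close>] by (simp add: cong_dvd_iff)
  then show "a \<in> E" using N_pos by (simp add: a_eq edge_iff verts_eq)
qed

lemma mem_base_edges_if_cong_difference:
  assumes "x \<in> V" and "y \<in> V" and "i < period B" and "[y - x = difference B i] (mod N)"
  shows "{x, y} \<in> base_edges N B (x - walk B i)"
proof -
  have "x mod N = x" using assms(1) by (simp add: verts_eq)
  moreover have "[y = x + difference B i] (mod N)"
    using assms(4) by (simp add: cong_iff_dvd_diff algebra_simps)
  then have "(x + difference B i) mod N = y" using assms(2) by (simp add: verts_eq cong_def)
  ultimately show ?thesis
    using assms(3) unfolding base_edges_def by (intro CollectI exI[of _ x] exI[of _ i]) simp
qed

lemma edges_covered:
  assumes "a \<in> E"
  obtains B t where "B \<in> \<B>" and "a \<in> base_edges N B t"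
proof -
  obtain x y where a_eq: "a = {x, y}" and verts: "x \<in> V" "y \<in> V" and "\<not> int m dvd y - x"
    using assms by (auto simp: edges_eq dvd_diff_commute)
  then obtain B i where "B \<in> \<B>" "i < period B" "cong_up_to_sign N (y - x) (difference B i)"
    using ex_difference by blast
  then consider (forward) "[y - x = difference B i] (mod N)"
    | (backward) "[x - y = difference B i] (mod N)"
    using cong_minus_minus_iff[of "x - y" "difference B i" N] by (auto simp: cong_up_to_sign_def)
  then show thesis
  proof cases
    case forward
    from mem_base_edges_if_cong_difference[OF verts \<open>i < period B\<close> this]
    show thesis unfolding a_eq[symmetric] by (rule that[OF \<open>B \<in> \<B>\<close>])
  next
    case backward
    from mem_base_edges_if_cong_difference[OF verts(2,1) \<open>i < period B\<close> this]
    show thesis unfolding insert_commute[of y] a_eq[symmetric] by (rule that[OF \<open>B \<in> \<B>\<close>])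
  qed
qed

lemma base_edges_disjoint:
  assumes in_family: "B \<in> \<B>" "B' \<in> \<B>"
    and common: "a \<in> base_edges N B t" "a \<in> base_edges N B' t'"
  shows "base_edges N B t = base_edges N B' t'"
proof -
  obtain x i where edge: "a = {x mod N, (x + difference B i) mod N}"
    and index: "i < period B" and start: "[x = walk B i + t] (mod int (period B))"
    using common(1) unfolding base_edges_def by blast
  obtain x' i' where edge': "a = {x' mod N, (x' + difference B' i') mod N}"
    and index': "i' < period B'" and start': "[x' = walk B' i' + t'] (mod int (period B'))"
    using common(2) unfolding base_edges_def by blast
  let ?s = "difference B i" and ?s' = "difference B' i'"
  consider (same) "[x = x'] (mod N)" "[x + ?s = x' + ?s'] (mod N)"
    | (swapped) "[x = x' + ?s'] (mod N)" "[x + ?s = x'] (mod N)"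
    using edge edge' unfolding cong_def by (metis doubleton_eq_iff)
  then show ?thesis
  proof cases
    case same
    then have "[?s = ?s'] (mod N)" using cong_diff by fastforce
    then have eq: "B = B'" "i = i'"
      using difference_eq_index in_family index index' by (auto simp: cong_up_to_sign_def)
    have "[x = x'] (mod int (period B))"
      using same(1) period_dvd[OF in_family(1)] m_dvd_N
      by (meson cong_dvd_modulus dvd_trans of_nat_dvd_iff)
    then have "[walk B i + t = walk B i + t'] (mod int (period B))"
      using start start' cong_sym cong_trans unfolding eq by meson
    then show ?thesis unfolding eq by (intro base_edges_cong) (simp add: cong_add_lcancel)
  next
    case swapped
    then have opposite: "[?s = - ?s'] (mod N)"
      using cong_diff[of "x + ?s" x' N x "x' + ?s'"] by simp
    then have "i = i'" "B = B'"
      using difference_eq_index in_family index index' by (auto simp: cong_up_to_sign_def)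
    then have "N dvd 2 * ?s" using opposite by (simp add: cong_iff_dvd_diff)
    then have "2 * ?s = 0"
      using difference_bound[OF in_family(1) index] by (intro dvd_imp_eq_0[of N]) auto
    then show ?thesis using not_dvd_difference[OF in_family(1) index] by simp
  qed
qed

definition system :: "int set set set" where
  "system = {base_edges N B t | B t. B \<in> \<B>}"

lemma hamiltonian_cycle_unfolded_cycle:
  assumes "B \<in> \<B>"
  shows "hamiltonian_cycle V E (unfolded_cycle N B t)"
proof -
  have "m * n \<ge> 2 * 2"
    using m_ge_2 even_n n_pos by (intro mult_le_mono) (auto elim!: evenE)
  then have "int (m * n) \<ge> 4" by linarith
  then have "nat N \<ge> 3" by (simp add: N_def)
  then have "length (unfolded_cycle N B t) \<ge> 3" by (simp add: unfolded_cycle_def)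
  then show ?thesis
    using unfolded_cycle_covers_residues[OF proper[OF assms] N_pos]
      cycle_edges_unfolded_cycle[OF proper[OF assms] N_pos] base_edges_subset[OF assms]
    by (simp add: hamiltonian_cycle_def verts_eq)
qed

lemma partition_on_system: "partition_on E system"
proof (rule partition_onI)
  show "\<Union> system = E"
  proof
    show "\<Union> system \<subseteq> E" using base_edges_subset unfolding system_def by blast
    show "E \<subseteq> \<Union> system"
    proof
      fix a assume "a \<in> E"
      then obtain B t where "B \<in> \<B>" "a \<in> base_edges N B t" by (rule edges_covered)
      then show "a \<in> \<Union> system" unfolding system_def by blast
    qed
  qed
  show "disjnt X Y" if "X \<in> system" "Y \<in> system" "X \<noteq> Y" for X Y
    using that base_edges_disjoint unfolding system_def disjnt_iff by blast
  show "{} \<notin> system"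
  proof
    assume "{} \<in> system"
    then obtain B t where "B \<in> \<B>" "base_edges N B t = {}" by (auto simp: system_def)
    then show False using range_walk_eq_base_edges[OF proper N_pos, of B t] by blast
  qed
qed

lemma multipartite_hcs_system: "multipartite_hcs m n system"
  unfolding multipartite_hcs_def hamiltonian_cycle_system_def
proof (intro conjI ballI partition_on_system)
  fix X assume "X \<in> system"
  then obtain B t where "B \<in> \<B>" "X = base_edges N B t" by (auto simp: system_def)
  then show "\<exists>c. hamiltonian_cycle V E c \<and> X = cycle_edges c"
    using hamiltonian_cycle_unfolded_cycle cycle_edges_unfolded_cycle[OF proper N_pos] by metis
qed

lemma translate_base_edges: "translate_edges u (base_edges N B t) = base_edges N B (t + u)"
proof -
  have image: "translate m n u ` {x mod N, (x + s) mod N} = {(x + u) mod N, (x + u + s) mod N}"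
    for x s
    by (simp add: translate_eq mod_simps algebra_simps)
  have shift: "[x + u = walk B i + (t + u)] (mod d) \<longleftrightarrow> [x = walk B i + t] (mod d)" for x i d
    by (simp add: cong_add_rcancel flip: add.assoc)
  show ?thesis
  proof (intro equalityI subsetI)
    fix a assume "a \<in> translate_edges u (base_edges N B t)"
    then obtain x i where "i < period B" "[x = walk B i + t] (mod int (period B))"
      "a = {(x + u) mod N, (x + u + difference B i) mod N}"
      unfolding base_edges_def using image by blast
    then show "a \<in> base_edges N B (t + u)" unfolding base_edges_def using shift by blast
  next
    fix a assume "a \<in> base_edges N B (t + u)"
    then obtain x i where "i < period B" and start: "[x = walk B i + (t + u)] (mod int (period B))"
      and a_eq: "a = {x mod N, (x + difference B i) mod N}"
      unfolding base_edges_def by blast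
    have "a = translate m n u ` {(x - u) mod N, (x - u + difference B i) mod N}"
      unfolding image a_eq by simp
    moreover have "[x - u = walk B i + t] (mod int (period B))"
      using start shift[of "x - u"] by simp
    ultimately show "a \<in> translate_edges u (base_edges N B t)"
      unfolding base_edges_def using \<open>i < period B\<close> by blast
  qed
qed

theorem cyclic_hcs_system: "cyclic_hcs m n system"
  unfolding cyclic_hcs_def cycle_edges_map
proof (intro conjI multipartite_hcs_system allI impI, elim conjE)
  fix c :: "int list" assume "cycle_edges c \<in> system"
  then obtain B t where "B \<in> \<B>" "cycle_edges c = base_edges N B t" by (auto simp: system_def)
  then show "translate_edges 1 (cycle_edges c) \<in> system"
    using translate_base_edges by (auto simp: system_def)
qed

theorem phi_symmetric_hcs_system: "phi_symmetric_hcs m n system"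
  unfolding phi_symmetric_hcs_def cycle_edges_map phi_def
proof (intro conjI multipartite_hcs_system allI impI, elim conjE)
  fix c :: "int list" assume "cycle_edges c \<in> system"
  then obtain B t where "B \<in> \<B>" and c_edges: "cycle_edges c = base_edges N B t"
    by (auto simp: system_def)
  have "[t + int m = t] (mod int (period B))"
    using period_dvd[OF \<open>B \<in> \<B>\<close>] by (simp add: cong_iff_dvd_diff)
  then show "translate_edges (int m) (cycle_edges c) = cycle_edges c"
    unfolding c_edges translate_base_edges by (rule base_edges_cong)
qed

end

section \<open>Differences along paths\<close>

definition path_lengths :: "nat \<Rightarrow> (nat \<Rightarrow> int) \<Rightarrow> int set" where
  "path_lengths d b = (\<lambda>i. \<bar>b (Suc i) - b i\<bar>) ` {..<d - 1}"

definition join_paths :: "nat \<Rightarrow> (nat \<Rightarrow> int) \<Rightarrow> (nat \<Rightarrow> int) \<Rightarrow> nat \<Rightarrow> int" where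
  "join_paths M f g i = (if i < M then f i else g (i - M))"

lemma path_lengths_add_mult:
  assumes "\<bar>s\<bar> = 1"
  shows "path_lengths d (\<lambda>i. c + s * b i) = path_lengths d b"
proof -
  have "\<bar>(c + s * b (Suc i)) - (c + s * b i)\<bar> = \<bar>b (Suc i) - b i\<bar>" for i
    using abs_mult[of s "b (Suc i) - b i"] assms by (simp add: right_diff_distrib)
  then show ?thesis by (simp add: path_lengths_def)
qed

lemma difference_lengths_Base_Cycle:
  assumes "d > 0"
  shows "difference_lengths (Base_Cycle d v b) =
    insert \<bar>b 0 + int d * v - b (d - 1)\<bar> (path_lengths d b)"
proof -
  have "{..<d} = insert (d - 1) {..<d - 1}" using assms by auto
  moreover have "difference (Base_Cycle d v b) (d - 1) = b 0 + int d * v - b (d - 1)"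
    using assms by (simp add: difference_def walk_def)
  moreover have "difference (Base_Cycle d v b) i = b (Suc i) - b i" if "i < d - 1" for i
    using that by (simp add: difference_def walk_def)
  ultimately show ?thesis by (simp add: difference_lengths_def path_lengths_def)
qed

lemma path_lengths_join_paths:
  assumes "M > 0" and "M' > 0"
  shows "path_lengths (M + M') (join_paths M f g) =
    insert \<bar>g 0 - f (M - 1)\<bar> (path_lengths M f \<union> path_lengths M' g)"
proof -
  let ?step = "\<lambda>i. \<bar>join_paths M f g (Suc i) - join_paths M f g i\<bar>"
  have "{..<M + M' - 1} = insert (M - 1) ({..<M - 1} \<union> (\<lambda>i. M + i) ` {..<M' - 1})"
  proof (intro equalityI subsetI)
    fix i assume "i \<in> {..<M + M' - 1}"
    then show "i \<in> insert (M - 1) ({..<M - 1} \<union> (\<lambda>i. M + i) ` {..<M' - 1})"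
      by (cases "i < M") (auto intro: image_eqI[of _ _ "i - M"])
  qed (use assms in auto)
  moreover have "?step (M - 1) = \<bar>g 0 - f (M - 1)\<bar>" using assms by (simp add: join_paths_def)
  moreover have "?step i = \<bar>f (Suc i) - f i\<bar>" if "i < M - 1" for i
    using that by (simp add: join_paths_def less_diff_conv)
  moreover have "?step (M + i) = \<bar>g (Suc i) - g i\<bar>" for i
    by (simp add: join_paths_def)
  ultimately show ?thesis
    by (simp add: path_lengths_def image_Un image_image)
qed

lemma inj_on_mod_add_mult:
  fixes b :: "nat \<Rightarrow> int"
  assumes "\<bar>s\<bar> = 1" and "inj_on (\<lambda>i. b i mod d) A"
  shows "inj_on (\<lambda>i. (c + s * b i) mod d) A"
proof (rule inj_onI)
  fix i j assume in_A: "i \<in> A" "j \<in> A" and "(c + s * b i) mod d = (c + s * b j) mod d"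
  then have "[s * b i = s * b j] (mod d)"
    by (simp only: cong_add_lcancel flip: cong_def)
  moreover have "coprime s d" using assms(1) by (metis coprime_abs_left_iff coprime_1_left)
  ultimately have "b i mod d = b j mod d"
    by (simp add: cong_mult_lcancel flip: cong_def)
  then show "i = j" using inj_onD[OF assms(2)] in_A by blast
qed

lemma inj_on_mod_join_paths:
  assumes f: "inj_on (\<lambda>i. f i mod int (2 * M)) {..<M}" "\<And>i. even (f i)"
    and g: "inj_on (\<lambda>i. g i mod int (2 * M)) {..<M}" "\<And>i. odd (g i)"
  shows "inj_on (\<lambda>i. join_paths M f g i mod int (2 * M)) {..<2 * M}"
proof (rule inj_onI)
  fix i j assume bounds: "i \<in> {..<2 * M}" "j \<in> {..<2 * M}"
    and eq: "join_paths M f g i mod int (2 * M) = join_paths M f g j mod int (2 * M)"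
  have parity: "even (join_paths M f g i mod int (2 * M)) \<longleftrightarrow> i < M" for i
    using f(2) g(2) by (simp add: join_paths_def dvd_mod_iff)
  consider (both_left) "i < M" "j < M" | (both_right) "i \<ge> M" "j \<ge> M"
    using parity[of i] parity[of j] eq by force
  then show "i = j"
  proof cases
    case both_left
    then show ?thesis using inj_onD[OF f(1), of i j] eq by (simp add: join_paths_def)
  next
    case both_right
    then have "i - M = j - M"
      using inj_onD[OF g(1), of "i - M" "j - M"] eq bounds by (auto simp: join_paths_def)
    then show ?thesis using both_right by simp
  qed
qed

section \<open>Zigzags\<close>

text \<open>Modulo \<open>2 * M\<close> the zigzag runs through \<open>0, -2, 2, -4, 4, \<dots>\<close>; the offset moves its differences
  into the \<open>k\<close>-th block of \<open>M - 1\<close> even lengths.\<close>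

definition zigzag :: "nat \<Rightarrow> nat \<Rightarrow> nat \<Rightarrow> int" where
  "zigzag M k i = (if even i then int i else - int (Suc i) - 2 * int M * int k)"

lemma even_zigzag: "even (zigzag M k i)"
  by (simp add: zigzag_def)

lemma zigzag_0 [simp]: "zigzag M k 0 = 0"
  by (simp add: zigzag_def)

lemma zigzag_last:
  assumes "M > 0"
  shows "zigzag M k (M - 1) = (if odd M then int M - 1 else - int M - 2 * int M * int k)"
  using assms by (simp add: zigzag_def of_nat_diff)

lemma inj_on_zigzag: "inj_on (\<lambda>i. zigzag M k i mod int (2 * M)) {..<M}"
proof -
  define r where "r i = (if even i then int i else int (2 * M) - int (Suc i))" for i
  have "zigzag M k i mod int (2 * M) = r i" if "i < M" for i
  proof -
    have "[zigzag M k i = r i] (mod int (2 * M))"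
      by (simp add: zigzag_def r_def cong_iff_dvd_diff)
    moreover have "0 \<le> r i" "r i < int (2 * M)" using that by (auto simp: r_def)
    ultimately show ?thesis by (simp add: cong_def)
  qed
  moreover have "inj_on r {..<M}" by (auto simp: inj_on_def r_def split: if_splits)
  ultimately show ?thesis by (simp add: inj_on_def)
qed

lemma path_lengths_zigzag:
  "path_lengths M (zigzag M k) =
    {x. even x \<and> 2 * int M * int k < x \<and> x < 2 * int M * int k + 2 * int M}"
proof -
  have "\<bar>zigzag M k (Suc i) - zigzag M k i\<bar> = 2 * int M * int k + 2 * int (Suc i)" for i
  proof -
    have "zigzag M k (Suc i) - zigzag M k i =
        (if even i then - 1 else 1) * (2 * int M * int k + 2 * int (Suc i))"
      by (simp add: zigzag_def)
    moreover have "2 * int M * int k + 2 * int (Suc i) \<ge> 0" by simp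
    ultimately show ?thesis by (simp only: abs_mult) simp
  qed
  then have "path_lengths M (zigzag M k) = (\<lambda>i. 2 * int M * int k + 2 * int (Suc i)) ` {..<M - 1}"
    by (simp add: path_lengths_def)
  also have "\<dots> = {x. even x \<and> 2 * int M * int k < x \<and> x < 2 * int M * int k + 2 * int M}"
  proof (intro equalityI subsetI)
    fix x assume "x \<in> {x. even x \<and> 2 * int M * int k < x \<and> x < 2 * int M * int k + 2 * int M}"
    then obtain y where "x = 2 * y" "int M * int k < y" "y < int M * int k + int M"
      by (auto elim: evenE)
    then show "x \<in> (\<lambda>i. 2 * int M * int k + 2 * int (Suc i)) ` {..<M - 1}"
      by (intro image_eqI[of _ _ "nat (y - int M * int k - 1)"]) auto
  qed auto
  finally show ?thesis .
qed

lemma ex_zigzag_length: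
  assumes "even x" and "0 < x" and "x < 2 * int M * int h" and "\<not> 2 * int M dvd x"
  obtains k where "k < h" and "x \<in> path_lengths M (zigzag M k)"
proof -
  define k where "k = nat (x div (2 * int M))"
  have "M > 0" using assms(2,3) by (auto intro!: Nat.gr0I)
  then have int_k: "int k = x div (2 * int M)"
    using assms(2) by (simp add: k_def pos_imp_zdiv_nonneg_iff)
  have "x mod (2 * int M) \<noteq> 0" "x mod (2 * int M) \<ge> 0" "x mod (2 * int M) < 2 * int M"
    using assms(4) \<open>M > 0\<close> by (simp_all add: dvd_eq_mod_eq_0)
  moreover have "x = 2 * int M * int k + x mod (2 * int M)" by (simp add: int_k)
  ultimately have bounds: "2 * int M * int k < x" "x < 2 * int M * int k + 2 * int M" by linarith+
  then have "2 * int M * int k < 2 * int M * int h" using assms(3) by linarith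
  then have "k < h" using \<open>M > 0\<close> by simp
  then show thesis using that[of k] bounds assms(1) by (simp add: path_lengths_zigzag)
qed

section \<open>The base cycles of the construction\<close>

definition pair_cycle :: "int \<Rightarrow> base_cycle" where
  "pair_cycle a = Base_Cycle 2 1 (\<lambda>i. if i = 0 then 0 else a + 2)"

definition zigzag_cycle :: "nat \<Rightarrow> nat \<Rightarrow> base_cycle" where
  "zigzag_cycle M k = Base_Cycle M 1 (zigzag M k)"

definition zigzag_pair_cycle :: "nat \<Rightarrow> nat \<Rightarrow> int \<Rightarrow> int \<Rightarrow> int \<Rightarrow> base_cycle" where
  "zigzag_pair_cycle M k v s \<delta> = Base_Cycle (2 * M) v
    (join_paths M (zigzag M k) (\<lambda>i. zigzag M k (M - 1) + \<delta> + s * zigzag M (Suc k) i))"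

lemma period_base_cycles [simp]:
  "period (pair_cycle a) = 2" "period (zigzag_cycle M k) = M"
  "period (zigzag_pair_cycle M k v s \<delta>) = 2 * M"
  by (simp_all add: pair_cycle_def zigzag_cycle_def zigzag_pair_cycle_def)

lemma difference_lengths_pair_cycle: "difference_lengths (pair_cycle a) = {\<bar>a\<bar>, \<bar>a + 2\<bar>}"
  by (simp add: pair_cycle_def difference_lengths_Base_Cycle path_lengths_def lessThan_Suc)

lemma difference_lengths_zigzag_cycle:
  assumes "odd M"
  shows "difference_lengths (zigzag_cycle M k) = insert 1 (path_lengths M (zigzag M k))"
  using odd_pos[OF assms] assms zigzag_last[of M k]
  by (simp add: zigzag_cycle_def difference_lengths_Base_Cycle)

lemma difference_lengths_zigzag_pair_cycle:
  assumes "M > 0" and "\<bar>s\<bar> = 1"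
  shows "difference_lengths (zigzag_pair_cycle M k v s \<delta>) =
    {\<bar>\<delta>\<bar>, \<bar>2 * int M * v - zigzag M k (M - 1) - \<delta> - s * zigzag M (Suc k) (M - 1)\<bar>} \<union>
    path_lengths M (zigzag M k) \<union> path_lengths M (zigzag M (Suc k))"
proof -
  let ?f = "zigzag M k" and ?g = "\<lambda>i. zigzag M k (M - 1) + \<delta> + s * zigzag M (Suc k) i"
  have "path_lengths (2 * M) (join_paths M ?f ?g) =
      insert \<bar>\<delta>\<bar> (path_lengths M (zigzag M k) \<union> path_lengths M (zigzag M (Suc k)))"
    using path_lengths_join_paths[OF assms(1,1), of ?f ?g]
    by (simp add: path_lengths_add_mult[OF assms(2)] flip: mult_2)
  moreover have "join_paths M ?f ?g 0 = 0" "join_paths M ?f ?g (2 * M - 1) = ?g (M - 1)"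
    using assms(1) by (simp_all add: join_paths_def)
  ultimately show ?thesis
    using assms(1) by (auto simp: zigzag_pair_cycle_def difference_lengths_Base_Cycle algebra_simps)
qed

lemma path_lengths_subset_zigzag_pair_cycle:
  assumes "M > 0" and "\<bar>s\<bar> = 1"
  shows "path_lengths M (zigzag M k) \<subseteq>
    difference_lengths (zigzag_pair_cycle M (2 * (k div 2)) v s \<delta>)"
proof -
  have "k = 2 * (k div 2) \<or> k = Suc (2 * (k div 2))" by presburger
  then show ?thesis unfolding difference_lengths_zigzag_pair_cycle[OF assms] by auto
qed

lemma proper_pair_cycle:
  assumes "even N" and "odd a"
  shows "proper_base_cycle N (pair_cycle a)"
  using assms by (auto simp: proper_base_cycle_def pair_cycle_def inj_on_def less_2_cases_iff
      odd_iff_mod_2_eq_one)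

lemma proper_zigzag_cycle:
  assumes "odd M" and "int M dvd N"
  shows "proper_base_cycle N (zigzag_cycle M k)"
proof -
  have "inj_on (\<lambda>i. zigzag M k i mod int M) {..<M}"
  proof (rule inj_onI)
    fix i j assume bounds: "i \<in> {..<M}" "j \<in> {..<M}"
      and "zigzag M k i mod int M = zigzag M k j mod int M"
    then have "[zigzag M k i = zigzag M k j] (mod int M)" by (simp add: cong_def)
    moreover have "[zigzag M k i = zigzag M k j] (mod 2)"
      using even_zigzag[of M k] by (simp add: cong_iff_dvd_diff)
    moreover have "coprime 2 (int M)" using assms(1) by simp
    ultimately have "[zigzag M k i = zigzag M k j] (mod int (2 * M))"
      by (simp add: coprime_cong_mult)
    then show "i = j" using inj_onD[OF inj_on_zigzag] bounds by (simp add: cong_def)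
  qed
  then show ?thesis using assms(2) by (simp add: proper_base_cycle_def zigzag_cycle_def)
qed

lemma proper_zigzag_pair_cycle:
  assumes "odd \<delta>" and "\<bar>s\<bar> = 1" and "int (2 * M) dvd N" and "coprime v (N div int (2 * M))"
  shows "proper_base_cycle N (zigzag_pair_cycle M k v s \<delta>)"
proof -
  have "inj_on (\<lambda>i. join_paths M (zigzag M k)
      (\<lambda>i. zigzag M k (M - 1) + \<delta> + s * zigzag M (Suc k) i) i mod int (2 * M)) {..<2 * M}"
    using assms(1) by (intro inj_on_mod_join_paths inj_on_mod_add_mult[OF assms(2)] inj_on_zigzag)
      (simp_all add: even_zigzag)
  then show ?thesis
    using assms(3,4) by (simp add: proper_base_cycle_def zigzag_pair_cycle_def)
qed

section \<open>Base cycles for \<open>m \<equiv> 2 (mod 4)\<close>\<close>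

text \<open>For \<open>M\<close> odd every zigzag ends at \<open>M - 1\<close>, so that two of them are joined by the differences
  \<open>a + 2\<close> and \<open>- a\<close> of a pair cycle; hence all odd differences are paired alike, except that for
  odd \<open>h\<close> the last zigzag closes up with difference \<open>1\<close>.\<close>

definition pair_start :: "nat \<Rightarrow> nat \<Rightarrow> int" where
  "pair_start h j = 2 * int (h mod 2) + 1 + 4 * int j"

definition odd_half_family :: "nat \<Rightarrow> nat \<Rightarrow> base_cycle set" where
  "odd_half_family M h =
    (\<lambda>j. zigzag_pair_cycle M (2 * j) 1 1 (pair_start h j + 2)) ` {..<h div 2} \<union>
    (\<lambda>j. pair_cycle (pair_start h j)) ` {h div 2..<M * h div 2} \<union>
    (if odd h then {zigzag_cycle M (h - 1)} else {})"

lemma difference_lengths_pair_subset_zigzag_pair_cycle: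
  assumes "odd M"
  shows "difference_lengths (pair_cycle a) \<subseteq> difference_lengths (zigzag_pair_cycle M k 1 1 (a + 2))"
  using odd_pos[OF assms] assms zigzag_last[of M]
  by (simp add: difference_lengths_pair_cycle difference_lengths_zigzag_pair_cycle)

lemma odd_half_family_covers_even:
  assumes "odd M" and "even x" and "0 < x" and "x < 2 * int M * int h" and "\<not> 2 * int M dvd x"
  shows "x \<in> (\<Union>B\<in>odd_half_family M h. difference_lengths B)"
proof -
  obtain k where "k < h" and in_zigzag: "x \<in> path_lengths M (zigzag M k)"
    using assms(2-5) by (rule ex_zigzag_length)
  show ?thesis
  proof (cases "k div 2 < h div 2")
    case True
    then show ?thesis
      using in_zigzag path_lengths_subset_zigzag_pair_cycle[OF odd_pos[OF assms(1)], of 1]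
      unfolding odd_half_family_def by fastforce
  next
    case False
    then have "odd h" "k = h - 1" using \<open>k < h\<close> by presburger+
    then show ?thesis
      using in_zigzag
      by (simp add: odd_half_family_def difference_lengths_zigzag_cycle[OF assms(1)])
  qed
qed

lemma odd_half_family_covers_odd:
  assumes "odd M" and "odd x" and "0 < x" and "x < 2 * int M * int h"
  shows "x \<in> (\<Union>B\<in>odd_half_family M h. difference_lengths B)"
proof (cases "odd h \<and> x = 1")
  case True
  then show ?thesis
    by (simp add: odd_half_family_def difference_lengths_zigzag_cycle[OF assms(1)])
next
  case False
  have "int M * int h = 2 * int (M * h div 2) + int (h mod 2)"
    by (metis odd_mult_eq_double_half[OF assms(1)] of_nat_add of_nat_mult of_nat_numeral)
  then have "x < 2 * int (h mod 2) + 1 + 4 * int (M * h div 2)"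
    using assms(4) by linarith
  moreover have "2 * int (h mod 2) + 1 \<le> x"
    using False assms(2,3) by (auto simp: mod2_eq_if elim!: oddE)
  ultimately obtain j where "j < M * h div 2"
    and in_pair: "x = pair_start h j \<or> x = pair_start h j + 2"
    unfolding pair_start_def
    using odd_in_consecutive_pairs[OF assms(2), of "2 * int (h mod 2) + 1"] by auto
  have "x \<in> difference_lengths (pair_cycle (pair_start h j))"
    using in_pair assms(3) by (auto simp: difference_lengths_pair_cycle)
  moreover from this
  have "x \<in> difference_lengths (zigzag_pair_cycle M (2 * j) 1 1 (pair_start h j + 2))"
    using difference_lengths_pair_subset_zigzag_pair_cycle[OF assms(1)] by blast
  ultimately show ?thesis
    using \<open>j < M * h div 2\<close> by (cases "j < h div 2") (auto simp: odd_half_family_def)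
qed

lemma sum_period_odd_half_family:
  assumes "odd M"
  shows "(\<Sum>B\<in>odd_half_family M h. period B) \<le> (2 * M - 1) * h"
proof -
  define q \<epsilon> P where "q = h div 2" and "\<epsilon> = h mod 2" and "P = M * h div 2"
  have h_eq: "h = 2 * q + \<epsilon>" and product: "M * h = 2 * P + \<epsilon>"
    using odd_mult_eq_double_half[OF assms, of h] by (simp_all add: q_def \<epsilon>_def P_def)
  have "h \<le> M * h" using odd_pos[OF assms] by simp
  then have "q \<le> P" using h_eq product by linarith
  let ?A = "(\<lambda>j. zigzag_pair_cycle M (2 * j) 1 1 (pair_start h j + 2)) ` {..<q}"
    and ?B = "(\<lambda>j. pair_cycle (pair_start h j)) ` {q..<P}"
    and ?C = "if odd h then {zigzag_cycle M (h - 1)} else {}"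
  have "(\<Sum>B\<in>odd_half_family M h. period B) \<le>
      (\<Sum>B\<in>?A. period B) + (\<Sum>B\<in>?B. period B) + (\<Sum>B\<in>?C. period B)"
    unfolding odd_half_family_def q_def P_def
    by (intro order_trans[OF sum_Un_le] add_right_mono sum_Un_le) simp_all
  also have "\<dots> \<le> q * (2 * M) + (P - q) * 2 + \<epsilon> * M"
    using sum_image_le_card_mult[of "{..<q}" period] sum_image_le_card_mult[of "{q..<P}" period]
    by (intro add_mono) (fastforce, fastforce, simp add: \<epsilon>_def mod2_eq_if)
  also have "\<dots> = M * h + M * h - h"
    using \<open>q \<le> P\<close> product by (simp add: h_eq algebra_simps)
  also have "\<dots> = (2 * M - 1) * h"
    by (simp add: diff_mult_distrib)
  finally show ?thesis .
qed

lemma base_cycle_family_odd_half: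
  assumes "odd M" and "h \<ge> 1"
  shows "base_cycle_family (2 * M) (2 * h) (odd_half_family M h)"
proof -
  have "M \<ge> 1" using odd_pos[OF assms(1)] by simp
  interpret multipartite "2 * M" "2 * h" using \<open>M \<ge> 1\<close> assms(2) by unfold_locales simp_all
  have N_eq: "N = int (2 * M) * (2 * int h)" by (simp add: N_def)
  have base_cycle: "proper_base_cycle N B \<and> period B dvd 2 * M" if "B \<in> odd_half_family M h" for B
    using that assms \<open>M \<ge> 1\<close> unfolding odd_half_family_def
    by (auto simp: N_eq pair_start_def split: if_splits
        intro!: proper_zigzag_pair_cycle proper_pair_cycle proper_zigzag_cycle)
  show ?thesis
  proof unfold_locales
    show "x \<in> (\<Union>B\<in>odd_half_family M h. difference_lengths B)"
      if "0 < x" "2 * x < N" "\<not> int (2 * M) dvd x" for x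
      using that assms(1) odd_half_family_covers_even odd_half_family_covers_odd
      by (cases "even x") (simp_all add: N_eq)
    show "2 * (\<Sum>B\<in>odd_half_family M h. period B) \<le> (2 * M - 1) * (2 * h)"
      using sum_period_odd_half_family[OF assms(1), of h] by simp
    show "finite (odd_half_family M h)" by (simp add: odd_half_family_def)
  qed (use \<open>M \<ge> 1\<close> base_cycle in auto)
qed

section \<open>Base cycles for \<open>m\<close> and \<open>n\<close> divisible by \<open>4\<close>\<close>

text \<open>For \<open>M\<close> even the ends of consecutive zigzags differ by \<open>m = 2 * M\<close>, so the joining odd
  differences sum to \<open>m * (v - 1)\<close> with \<open>v\<close> prime to \<open>n = 4 * q\<close>.  With \<open>v = 2 * q + 1\<close> they are
  mirror images in the range of odd differences, whose middle part is then paired consecutively.\<close>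

definition even_half_family :: "nat \<Rightarrow> nat \<Rightarrow> base_cycle set" where
  "even_half_family M q =
    (\<lambda>j. zigzag_pair_cycle M (2 * j) (2 * int q + 1) (- 1) (2 * int j + 1)) ` {..<q} \<union>
    (\<lambda>j. pair_cycle (2 * int q + 1 + 4 * int j)) ` {..<M * q - q}"

lemma odd_lengths_zigzag_pair_cycle:
  assumes "even M" and "M > 0" and "j < q"
  shows "{2 * int j + 1, 4 * int M * int q - (2 * int j + 1)} \<subseteq>
    difference_lengths (zigzag_pair_cycle M (2 * j) (2 * int q + 1) (- 1) (2 * int j + 1))"
proof -
  have "2 * int M * (2 * int q + 1) - zigzag M (2 * j) (M - 1) - (2 * int j + 1)
      + zigzag M (Suc (2 * j)) (M - 1) = 4 * int M * int q - (2 * int j + 1)"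
    using assms(1,2) by (simp only: zigzag_last) (simp add: algebra_simps)
  moreover have "int j < int M * int q"
  proof -
    have "q \<le> M * q" using assms(2) by simp
    then have "j < M * q" using assms(3) by linarith
    then show ?thesis by (simp flip: of_nat_mult)
  qed
  ultimately show ?thesis
    using assms(2) by (simp add: difference_lengths_zigzag_pair_cycle)
qed

lemma even_half_family_covers_even:
  assumes "M > 0" and "even x" and "0 < x" and "x < 4 * int M * int q" and "\<not> 2 * int M dvd x"
  shows "x \<in> (\<Union>B\<in>even_half_family M q. difference_lengths B)"
proof -
  obtain k where "k < 2 * q" and in_zigzag: "x \<in> path_lengths M (zigzag M k)"
    using ex_zigzag_length[of x M "2 * q"] assms by auto
  then have "k div 2 < q" by presburger
  then show ?thesis
    using in_zigzag path_lengths_subset_zigzag_pair_cycle[OF assms(1), of "- 1"]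
    unfolding even_half_family_def by fastforce
qed

lemma even_half_family_covers_odd:
  assumes "even M" and "M > 0" and "odd x" and "0 < x" and "x < 4 * int M * int q"
  shows "x \<in> (\<Union>B\<in>even_half_family M q. difference_lengths B)"
proof -
  have zigzag_pair: ?thesis
    if "j < q" "x = 2 * int j + 1 \<or> x = 4 * int M * int q - (2 * int j + 1)" for j
    using odd_lengths_zigzag_pair_cycle[OF assms(1,2) that(1)] that
    unfolding even_half_family_def by blast
  consider (low) "x < 2 * int q + 1" | (high) "x > 4 * int M * int q - 2 * int q"
    | (middle) "2 * int q + 1 \<le> x" "x \<le> 4 * int M * int q - 2 * int q" by linarith
  then show ?thesis
  proof cases
    case low
    then show ?thesis using assms(3,4) by (intro zigzag_pair[of "nat (x div 2)"]) (auto elim!: oddE)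
  next
    case high
    then show ?thesis
      using assms(3,5)
      by (intro zigzag_pair[of "nat (2 * int M * int q - 1 - x div 2)"]) (auto elim!: oddE)
  next
    case middle
    have "q \<le> M * q" using assms(2) by simp
    then have "x < 2 * int q + 1 + 4 * int (M * q - q)" using middle(2) by (simp add: of_nat_diff)
    then obtain j where "j < M * q - q"
      "x = 2 * int q + 1 + 4 * int j \<or> x = 2 * int q + 1 + 4 * int j + 2"
      using odd_in_consecutive_pairs[OF assms(3), of "2 * int q + 1"] middle(1) by auto
    moreover from this have "x \<in> difference_lengths (pair_cycle (2 * int q + 1 + 4 * int j))"
      by (auto simp: difference_lengths_pair_cycle)
    ultimately show ?thesis unfolding even_half_family_def by blast
  qed
qed

lemma sum_period_even_half_family:
  assumes "M > 0"
  shows "(\<Sum>B\<in>even_half_family M q. period B) \<le> (2 * M - 1) * (2 * q)"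
proof -
  let ?A = "(\<lambda>j. zigzag_pair_cycle M (2 * j) (2 * int q + 1) (- 1) (2 * int j + 1)) ` {..<q}"
    and ?B = "(\<lambda>j. pair_cycle (2 * int q + 1 + 4 * int j)) ` {..<M * q - q}"
  have "(\<Sum>B\<in>even_half_family M q. period B) \<le> (\<Sum>B\<in>?A. period B) + (\<Sum>B\<in>?B. period B)"
    unfolding even_half_family_def by (rule sum_Un_le) simp_all
  also have "\<dots> \<le> q * (2 * M) + (M * q - q) * 2"
    using sum_image_le_card_mult[of "{..<q}" period]
      sum_image_le_card_mult[of "{..<M * q - q}" period]
    by (intro add_mono) fastforce+
  also have "\<dots> = (2 * M - 1) * (2 * q)"
  proof -
    have "q \<le> M * q" using assms by simp
    then show ?thesis by (simp add: diff_mult_distrib)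
  qed
  finally show ?thesis .
qed

lemma base_cycle_family_even_half:
  assumes "even M" and "M > 0" and "q \<ge> 1"
  shows "base_cycle_family (2 * M) (4 * q) (even_half_family M q)"
proof -
  interpret multipartite "2 * M" "4 * q" using assms by unfold_locales simp_all
  have N_eq: "N = int (2 * M) * (4 * int q)" by (simp add: N_def)
  have coprime: "coprime (2 * int q + 1) (4 * int q)"
  proof -
    have "coprime (2 * int q + 1) (2 * int q)" by (rule coprime_add_one_left)
    moreover have "coprime (2 * int q + 1) 2" by simp
    moreover have "4 * int q = 2 * (2 * int q)" by simp
    ultimately show ?thesis by (simp only: coprime_mult_right_iff)
  qed
  have base_cycle: "proper_base_cycle N B \<and> period B dvd 2 * M" if "B \<in> even_half_family M q" for B
    using that assms coprime unfolding even_half_family_def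
    by (auto simp: N_eq intro!: proper_zigzag_pair_cycle proper_pair_cycle)
  show ?thesis
  proof unfold_locales
    show "x \<in> (\<Union>B\<in>even_half_family M q. difference_lengths B)"
      if "0 < x" "2 * x < N" "\<not> int (2 * M) dvd x" for x
      using that assms even_half_family_covers_even even_half_family_covers_odd
      by (cases "even x") (simp_all add: N_eq)
    show "2 * (\<Sum>B\<in>even_half_family M q. period B) \<le> (2 * M - 1) * (4 * q)"
      using sum_period_even_half_family[OF assms(2), of q] by (simp add: mult_ac)
    show "finite (even_half_family M q)" by (simp add: even_half_family_def)
  qed (use assms base_cycle in auto)
qed

lemma ex_base_cycle_family:
  assumes "m \<ge> 2" and "even m" and "n \<ge> 1" and "even n" and "n mod 4 = 2 \<longrightarrow> m mod 4 = 2"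
  obtains \<B> where "base_cycle_family m n \<B>"
proof -
  obtain M h where halves: "m = 2 * M" "n = 2 * h" using assms(2,4) by (auto elim!: evenE)
  show thesis
  proof (cases "odd M")
    case True
    then show thesis using that base_cycle_family_odd_half[of M h] assms(3) halves by simp
  next
    case False
    then have "4 dvd n" using assms(4,5) halves by presburger
    then obtain q where "n = 4 * q" by (elim dvdE)
    then show thesis
      using that base_cycle_family_even_half[of M q] False assms(1,3) halves(1) by simp
  qed
qed

theorem theorem1p1:
  fixes m n :: nat
  assumes "m \<ge> 2" and "even m" and "n \<ge> 1"
  shows "(\<exists>\<H>. cyclic_hcs m n \<H> \<and> phi_symmetric_hcs m n \<H>) \<longleftrightarrow>
         even n \<and> (n mod 4 = 2 \<longrightarrow> m mod 4 = 2)"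
proof
  assume "\<exists>\<H>. cyclic_hcs m n \<H> \<and> phi_symmetric_hcs m n \<H>"
  then obtain \<H> where "cyclic_hcs m n \<H>" "phi_symmetric_hcs m n \<H>" by blast
  then interpret cyclic_symmetric_system m n \<H>
    using assms by unfold_locales simp_all
  show "even n \<and> (n mod 4 = 2 \<longrightarrow> m mod 4 = 2)"
    using even_n m_mod_4_eq_2 by blast
next
  assume "even n \<and> (n mod 4 = 2 \<longrightarrow> m mod 4 = 2)"
  then obtain \<B> where "base_cycle_family m n \<B>"
    using assms ex_base_cycle_family by blast
  then interpret base_cycle_family m n \<B> .
  show "\<exists>\<H>. cyclic_hcs m n \<H> \<and> phi_symmetric_hcs m n \<H>"
    using cyclic_hcs_system phi_symmetric_hcs_system by blast
qed

end
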